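(* Let $\mathcal G$ be the group of interval exchange transformations of $[0,1)$ and, for each positive integer $m$, let $\mathcal G_m\subset\mathcal G$ be the set of elements having at most $m$ discontinuity points. If for every positive integer $m$ the quantity $$C_m(\mathcal G):=\sup\{c_{\mathcal G}(g): g\in[\mathcal G,\mathcal G]\cap\mathcal G_m\}$$ is finite, then $\mathcal G$ is uniformly perfect and $c(\mathcal G)\leq 5$.
   Context: Let $I=[0,1)$. An interval exchange transformation (IET) of $I$ is a right-continuous bijection $f:I\to I$ defined by a finite partition of $I$ into half-open subintervals $[a_i,a_{i+1})$ and a reordering of these intervals by translations. $\mathcal G$ is the group of all IET of $I$ under composition. By convention every IET is considered discontinuous at the left endpoint $0$ of $I$; $BP(f)$ denotes the set of discontinuity points of $f$ (including $0$), so that $\mathcal G_m=\{f\in\mathcal G:\#BP(f)\le m\}$. For a group $G$, a commutator is an element $[f,g]=fgf^{-1}g^{-1}$ with $f,g\in G$, and $[G,G]$ is the subgroup generated by commutators. For $g\in[G,G]$, the commutator length $c_G(g)$ is the least number $c$ such that $g$ is a product of $c$ commutators of $G$, and $c(G)=\sup\{c_G(g): g\in[G,G]\}$. In this convention, $G$ is called uniformly perfect if $c(G)$ is finite (it is not required that $G=[G,G]$). *)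

theory Defs
  imports "HOL-Analysis.Analysis" "HOL-Algebra.Bij" "HOL-Algebra.Generated_Groups"
    "HOL-Library.Extended_Nat"
begin

text \<open>Maps of \<open>[0,1)\<close> are extensional functions (value \<open>undefined\<close> outside \<open>[0,1)\<close>), as in
  the library group \<open>BijGroup\<close>, so that equal maps are equal group elements.\<close>

abbreviation unit_ivl :: "real set" where
  "unit_ivl \<equiv> {0..<1}"

text \<open>Bijectivity makes the translated pieces tile \<open>[0,1)\<close> again, i.e. the translations reorder
  the intervals; right continuity comes from the pieces being half-open on the right.\<close>

definition is_iet :: "(real \<Rightarrow> real) \<Rightarrow> bool" where
  "is_iet f \<longleftrightarrow> f \<in> Bij unit_ivl \<and>
     (\<exists>(n::nat) (a :: nat \<Rightarrow> real) (t :: nat \<Rightarrow> real).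
        a 0 = 0 \<and> a n = 1 \<and> (\<forall>i<n. a i < a (Suc i)) \<and>
        (\<forall>i<n. \<forall>x\<in>{a i..<a (Suc i)}. f x = x + t i))"

definition IET :: "(real \<Rightarrow> real) monoid" where
  "IET = (BijGroup unit_ivl)\<lparr>carrier := {f. is_iet f}\<rparr>"

definition BP :: "(real \<Rightarrow> real) \<Rightarrow> real set" where
  "BP f = insert 0 {x \<in> unit_ivl. \<not> continuous (at x within unit_ivl) f}"

text \<open>Finiteness is required explicitly because \<open>card\<close> of an infinite set is \<open>0\<close>.\<close>

definition IET_upto :: "nat \<Rightarrow> (real \<Rightarrow> real) set" where
  "IET_upto m = {f \<in> carrier IET. finite (BP f) \<and> card (BP f) \<le> m}"

text \<open>The infimum of the empty set in \<open>enat\<close> is \<open>\<infinity>\<close>: this is the value outside the derived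
  subgroup. The empty product is \<open>\<one>\<close>, so the identity has length \<open>0\<close>.\<close>

definition commutator_length :: "('a, 'b) monoid_scheme \<Rightarrow> 'a \<Rightarrow> enat" where
  "commutator_length G g =
     Inf {enat (length cs) | cs. set cs \<subseteq> derived_set G (carrier G) \<and> foldr (\<otimes>\<^bsub>G\<^esub>) cs \<one>\<^bsub>G\<^esub> = g}"

definition commutator_width :: "('a, 'b) monoid_scheme \<Rightarrow> enat" where
  "commutator_width G = (SUP g\<in>derived G (carrier G). commutator_length G g)"

text \<open>Perfectness of \<open>G\<close> itself is not required.\<close>

definition uniformly_perfect :: "('a, 'b) monoid_scheme \<Rightarrow> bool" where
  "uniformly_perfect G \<longleftrightarrow> commutator_width G < \<infinity>"

definition commutator_width_upto :: "nat \<Rightarrow> enat" where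
  "commutator_width_upto m =
     (SUP g\<in>derived IET (carrier IET) \<inter> IET_upto m. commutator_length IET g)"

end

theory Submission
  imports Defs
begin

text \<open>
  Every element \<open>f\<close> of the commutator subgroup is in fact a product of four commutators.

  Let \<open>A\<close> be the set of left end points of the intervals that \<open>f\<close> translates, let \<open>\<delta>\<close> be small, and let
  \<open>K\<close> be the union of the intervals \<open>[a, a + \<delta>)\<close>, \<open>a \<in> A\<close>. A pigeonhole argument shows that an orbit
  which avoids \<open>K\<close> is periodic (\<open>translated_orbit_periodic\<close>). Hence the first return map of \<open>f\<close> to \<open>K\<close>,
  extended by the identity, is an interval exchange \<open>h\<close>, and \<open>f = h \<circ> E\<close> where \<open>E\<close> runs cyclically
  through the floors of the return towers and is therefore pointwise periodic
  (\<open>first_return_decomposition\<close>). The number of break points of \<open>h\<close> is at most \<open>4 * card A\<close>, whatever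
  \<open>\<delta>\<close> is.

  A pointwise periodic interval exchange permutes finitely many intervals by translations. A
  permutation of finite order is a product of two involutions, and an involution that permutes
  intervals of equal lengths is a commutator, because it acts in the same way on the left and on the
  right halves of the intervals. So \<open>E\<close> is a product of two commutators
  (\<open>periodic_two_commutators\<close>).

  For \<open>h\<close>, conjugate by an interval exchange with few break points that moves \<open>K\<close> into \<open>[0, 1 / n)\<close>
  (\<open>gather\<close>), and rescale \<open>[0, 1 / n)\<close> to \<open>[0, 1)\<close>. This yields an interval exchange \<open>g\<close> whose number of
  break points is bounded independently of \<open>\<delta>\<close> and \<open>n\<close>. It lies again in the commutator subgroup:
  exchanges of two adjacent intervals generate the group, their classes in the abelianization are
  biadditive in the two lengths, and so \<open>g\<close> has the same class as the fourth power of its copy of half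
  the size (\<open>derived_shrink_2\<close>). By hypothesis \<open>g\<close> is a product of \<open>m\<close> commutators, where \<open>m\<close> depends
  on \<open>f\<close> only; choosing \<open>n \<ge> m\<close> leaves room for \<open>n\<close> disjoint copies of \<open>[0, 1 / n)\<close>, on which the \<open>n\<close>
  commutators can be formed simultaneously. One further commutator transports them all into
  \<open>[0, 1 / n)\<close>, so \<open>h\<close> is a product of two commutators (\<open>shrink_two_commutators\<close>).
\<close>

section \<open>Interval exchanges and their break points\<close>

text \<open>\<open>f\<close> is a translation on every subinterval of \<open>[0,1)\<close> that meets \<open>A\<close> at most in its left end point.
  The set \<open>A\<close> may contain points at which \<open>f\<close> is continuous, and points outside \<open>[0,1)\<close>.\<close>

definition translates_off :: "real set \<Rightarrow> (real \<Rightarrow> real) \<Rightarrow> bool" where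
  "translates_off A f \<longleftrightarrow>
     (\<forall>x y. 0 \<le> x \<longrightarrow> x \<le> y \<longrightarrow> y < 1 \<longrightarrow> A \<inter> {x<..y} = {} \<longrightarrow> f y = f x + (y - x))"

lemma translates_offI:
  assumes "\<And>x y. 0 \<le> x \<Longrightarrow> x \<le> y \<Longrightarrow> y < 1 \<Longrightarrow> A \<inter> {x<..y} = {} \<Longrightarrow> f y = f x + (y - x)"
  shows "translates_off A f"
  unfolding translates_off_def by (intro allI impI) (rule assms)

lemma translates_offD:
  assumes "translates_off A f" "0 \<le> x" "x \<le> y" "y < 1" "A \<inter> {x<..y} = {}"
  shows "f y = f x + (y - x)"
  using assms unfolding translates_off_def by blast

lemma translates_off_cong:
  assumes "translates_off A f" "\<And>x. x \<in> unit_ivl \<Longrightarrow> f x = g x"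
  shows "translates_off A g"
proof (rule translates_offI)
  fix x y :: real assume *: "0 \<le> x" "x \<le> y" "y < 1" "A \<inter> {x<..y} = {}"
  show "g y = g x + (y - x)"
    using translates_offD[OF assms(1) *] assms(2)[of x] assms(2)[of y] * by auto
qed

lemma partition_piece:
  fixes a :: "nat \<Rightarrow> real"
  assumes "a 0 \<le> x" "x < a n"
  shows "\<exists>i<n. a i \<le> x \<and> x < a (Suc i)"
  using assms(2)
proof (induction n)
  case (Suc n)
  then show ?case by (cases "x < a n") (auto simp: less_Suc_eq)
qed (use assms in auto)

text \<open>An unordered finite set of break points replaces the increasing sequence of end points.\<close>

lemma is_iet_iff: "is_iet f \<longleftrightarrow> f \<in> Bij unit_ivl \<and> (\<exists>A. finite A \<and> translates_off A f)"
proof (intro iffI conjI; (elim conjE exE)?)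
  assume f: "is_iet f"
  then show "f \<in> Bij unit_ivl" by (simp add: is_iet_def)
  from f obtain n a t where a: "a 0 = (0::real)" "a n = 1" "\<And>i. i < n \<Longrightarrow> a i < a (Suc i)"
    "\<And>i x. i < n \<Longrightarrow> x \<in> {a i..<a (Suc i)} \<Longrightarrow> f x = x + t i"
    unfolding is_iet_def by metis
  have "translates_off (a ` {..n}) f"
  proof (rule translates_offI)
    fix x y :: real assume *: "0 \<le> x" "x \<le> y" "y < 1" "a ` {..n} \<inter> {x<..y} = {}"
    obtain i where i: "i < n" "a i \<le> x" "x < a (Suc i)"
      using partition_piece[of a x n] a * by auto
    have "a (Suc i) \<in> a ` {..n}" using i by auto
    then have "y < a (Suc i)"
      using *(4) i by (meson disjoint_iff greaterThanAtMost_iff not_le)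
    then show "f y = f x + (y - x)"
      using a(4)[of i x] a(4)[of i y] i * by auto
  qed
  then show "\<exists>A. finite A \<and> translates_off A f" by blast
next
  fix A assume f: "f \<in> Bij unit_ivl" and A: "finite A" "translates_off A f"
  define B where "B = insert 1 (insert 0 (A \<inter> unit_ivl))"
  define xs where "xs = sorted_list_of_set B"
  define n where "n = card B - 1"
  have finB: "finite B" using A by (simp add: B_def)
  have set: "set xs = B" and len: "length xs = card B" and sor: "sorted_wrt (<) xs"
    using finB by (auto simp: xs_def)
  have "card {0,1::real} \<le> card B" by (rule card_mono[OF finB]) (auto simp: B_def)
  then have cardB: "card B = Suc n" "n \<ge> 1" by (auto simp: n_def)
  have mono: "xs ! i < xs ! j" if "i < j" "j \<le> n" for i j
    using sor that len cardB by (auto simp: sorted_wrt_iff_nth_less)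
  have mono': "xs ! i \<le> xs ! j" if "i \<le> j" "j \<le> n" for i j
    using mono[of i j] that by (cases "i = j") auto
  have elem: "\<exists>i\<le>n. xs ! i = b" if "b \<in> B" for b
    using that set len cardB by (metis in_set_conv_nth less_Suc_eq_le)
  have bnd: "0 \<le> b \<and> b \<le> 1" if "b \<in> B" for b
    using that by (auto simp: B_def)
  have nthB: "xs ! i \<in> B" if "i \<le> n" for i
    using that set len cardB nth_mem by fastforce
  obtain i where i: "i \<le> n" "xs ! i = 0" using elem[of 0] by (auto simp: B_def)
  have x0: "xs ! 0 = 0" using mono'[of 0 i] i bnd[OF nthB[of 0]] by auto
  obtain j where j: "j \<le> n" "xs ! j = 1" using elem[of 1] by (auto simp: B_def)
  have xn: "xs ! n = 1" using mono'[of j n] j bnd[OF nthB[of n]] by auto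
  have tr: "f x = x + (f (xs ! k) - xs ! k)" if k: "k < n" and x: "x \<in> {xs ! k..<xs ! Suc k}" for k x
  proof -
    have "f x = f (xs ! k) + (x - xs ! k)"
    proof (rule translates_offD[OF A(2)])
      show "0 \<le> xs ! k" using bnd[OF nthB[of k]] k by auto
      show "xs ! k \<le> x" "x < 1" using x bnd[OF nthB[of "Suc k"]] k by auto
      show "A \<inter> {xs ! k<..x} = {}"
      proof (rule ccontr)
        assume "A \<inter> {xs ! k<..x} \<noteq> {}"
        then obtain b where b: "b \<in> A" "xs ! k < b" "b \<le> x" by auto
        have "b \<in> B" using b \<open>0 \<le> xs ! k\<close> \<open>x < 1\<close> by (auto simp: B_def)
        then obtain l where l: "l \<le> n" "xs ! l = b" using elem by blast
        have "k < l" using mono'[of l k] l b k by force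
        then show False using mono'[of "Suc k" l] l b x by auto
      qed
    qed
    then show ?thesis by simp
  qed
  have "\<forall>i<n. xs ! i < xs ! Suc i" using mono by auto
  moreover have "\<forall>i<n. \<forall>x\<in>{xs ! i..<xs ! Suc i}. f x = x + (f (xs ! i) - xs ! i)"
    using tr by blast
  ultimately show "is_iet f" unfolding is_iet_def using f x0 xn
    by (intro conjI exI[of _ n] exI[of _ "(!) xs"] exI[of _ "\<lambda>k. f (xs ! k) - xs ! k"])
qed

lemma translates_off_compose:
  assumes f: "translates_off A f" and g: "translates_off B g" and gI: "bij_betw g unit_ivl unit_ivl"
  shows "translates_off (B \<union> inv_into unit_ivl g ` (A \<inter> unit_ivl)) (\<lambda>x. f (g x))"
proof (rule translates_offI)
  fix x y :: real
  assume *: "0 \<le> x" "x \<le> y" "y < 1" and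
    dis: "(B \<union> inv_into unit_ivl g ` (A \<inter> unit_ivl)) \<inter> {x<..y} = {}"
  have tr: "g z = g x + (z - x)" if "x \<le> z" "z \<le> y" for z
    by (rule translates_offD[OF g]) (use * dis that in auto)
  have gx: "g x \<in> unit_ivl" "g y \<in> unit_ivl" using * gI by (auto simp: bij_betw_def)
  have "f (g y) = f (g x) + (g y - g x)"
  proof (rule translates_offD[OF f])
    show "A \<inter> {g x<..g y} = {}"
    proof (rule ccontr)
      assume "A \<inter> {g x<..g y} \<noteq> {}"
      then obtain a where a: "a \<in> A" "g x < a" "a \<le> g y" by auto
      define z where "z = x + (a - g x)"
      have z: "x < z" "z \<le> y" using a tr[of y] * by (auto simp: z_def)
      have "g z = a" using tr[of z] z by (auto simp: z_def)
      moreover have "z \<in> unit_ivl" using z * by auto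
      ultimately have "inv_into unit_ivl g a = z"
        using gI by (metis bij_betw_inv_into_left)
      moreover have "a \<in> unit_ivl" using a gx by auto
      ultimately show False using dis a z by force
    qed
  qed (use gx tr[of y] * in auto)
  then show "f (g y) = f (g x) + (y - x)" using tr[of y] * by auto
qed

lemma translates_off_inverse:
  assumes f: "translates_off A f" and A: "finite A" and fI: "bij_betw f unit_ivl unit_ivl"
  shows "translates_off (f ` insert 0 (A \<inter> unit_ivl)) (inv_into unit_ivl f)"
proof (rule translates_offI)
  fix x y :: real
  assume *: "0 \<le> x" "x \<le> y" "y < 1" and
    dis: "f ` insert 0 (A \<inter> unit_ivl) \<inter> {x<..y} = {}"
  define v where "v = inv_into unit_ivl f y"
  have v: "v \<in> unit_ivl" "f v = y"
    using * fI by (auto simp: v_def bij_betw_def f_inv_into_f intro!: inv_into_into[of y f unit_ivl, simplified])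
  define S where "S = {a \<in> insert 0 (A \<inter> unit_ivl). a \<le> v}"
  have S: "finite S" "0 \<in> S" using A v by (auto simp: S_def)
  define a where "a = Max S"
  have a: "a \<in> S" using S unfolding a_def by (intro Max_in) auto
  have amax: "b \<le> a" if "b \<in> S" for b using that S by (auto simp: a_def)
  have a0: "0 \<le> a" using amax S by auto
  have tr: "f z = f a + (z - a)" if "a \<le> z" "z \<le> v" for z
  proof (rule translates_offD[OF f])
    show "A \<inter> {a<..z} = {}"
    proof (rule ccontr)
      assume "A \<inter> {a<..z} \<noteq> {}"
      then obtain b where b: "b \<in> A" "a < b" "b \<le> z" by auto
      then have "b \<in> S" using that v a0 by (auto simp: S_def)
      then show False using amax b by force
    qed
  qed (use that a0 v in auto)
  have av: "a \<le> v" using a by (auto simp: S_def)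
  have "f a \<le> y" using tr[of v] v av by auto
  then have "f a \<le> x" using dis a by (force simp: S_def)
  define u where "u = v - (y - x)"
  have u: "a \<le> u" "u \<le> v" using \<open>f a \<le> x\<close> tr[of v] v av * by (auto simp: u_def)
  have "f u = x" using tr[of u] tr[of v] u v av by (auto simp: u_def)
  moreover have "u \<in> unit_ivl" using u a0 v by auto
  ultimately have "inv_into unit_ivl f x = u" using fI by (metis bij_betw_inv_into_left)
  then show "inv_into unit_ivl f y = inv_into unit_ivl f x + (y - x)" by (simp add: u_def flip: v_def)
qed

lemma iet_subgroup: "subgroup {f. is_iet f} (BijGroup unit_ivl)"
proof -
  interpret B: group "BijGroup unit_ivl" by (rule group_BijGroup)
  have bij: "bij_betw f unit_ivl unit_ivl" if "is_iet f" for f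
    using that by (auto simp: is_iet_iff Bij_def)
  show ?thesis
  proof (rule B.subgroupI)
    show "{f. is_iet f} \<subseteq> carrier (BijGroup unit_ivl)"
      by (auto simp: BijGroup_def is_iet_iff)
    have "is_iet (\<lambda>x\<in>unit_ivl. x)"
      unfolding is_iet_iff by (auto simp: id_Bij intro!: exI[of _ "{}"] translates_offI)
    then show "{f. is_iet f} \<noteq> {}" by blast
  next
    fix f assume "f \<in> {f. is_iet f}"
    then have f: "is_iet f" by simp
    then obtain A where A: "finite A" "translates_off A f" and fB: "f \<in> Bij unit_ivl"
      by (auto simp: is_iet_iff)
    have "inv\<^bsub>BijGroup unit_ivl\<^esub> f = restrict (inv_into unit_ivl f) unit_ivl"
      using fB by (rule inv_BijGroup)
    moreover have "is_iet (restrict (inv_into unit_ivl f) unit_ivl)"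
      unfolding is_iet_iff
    proof (intro conjI exI)
      show "restrict (inv_into unit_ivl f) unit_ivl \<in> Bij unit_ivl"
        using fB by (rule restrict_inv_into_Bij)
      show "finite (f ` insert 0 (A \<inter> unit_ivl))" using A by auto
      show "translates_off (f ` insert 0 (A \<inter> unit_ivl)) (restrict (inv_into unit_ivl f) unit_ivl)"
        by (rule translates_off_cong[OF translates_off_inverse[OF A(2,1) bij[OF f]]]) auto
    qed
    ultimately show "inv\<^bsub>BijGroup unit_ivl\<^esub> f \<in> {f. is_iet f}" by simp
  next
    fix f g assume "f \<in> {f. is_iet f}" "g \<in> {f. is_iet f}"
    then have f: "is_iet f" and g: "is_iet g" by auto
    obtain A B where A: "finite A" "translates_off A f" and B: "finite B" "translates_off B g"
      and fg: "f \<in> Bij unit_ivl" "g \<in> Bij unit_ivl" using f g by (auto simp: is_iet_iff)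
    have "is_iet (compose unit_ivl f g)" unfolding is_iet_iff
    proof (intro conjI exI)
      show "compose unit_ivl f g \<in> Bij unit_ivl" using fg by (rule compose_Bij)
      show "finite (B \<union> inv_into unit_ivl g ` (A \<inter> unit_ivl))" using A B by auto
      show "translates_off (B \<union> inv_into unit_ivl g ` (A \<inter> unit_ivl)) (compose unit_ivl f g)"
        by (rule translates_off_cong[OF translates_off_compose[OF A(2) B(2) bij[OF g]]])
           (auto simp: compose_def)
    qed
    then show "f \<otimes>\<^bsub>BijGroup unit_ivl\<^esub> g \<in> {f. is_iet f}"
      using fg by (simp add: BijGroup_def)
  qed
qed

lemma group_IET: "group IET"
  unfolding IET_def by (rule subgroup.subgroup_is_group[OF iet_subgroup group_BijGroup])

interpretation G: group IET by (rule group_IET)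

lemma carrier_IET: "f \<in> carrier IET \<longleftrightarrow> is_iet f"
  by (simp add: IET_def)

lemma IET_bij: "f \<in> carrier IET \<Longrightarrow> bij_betw f unit_ivl unit_ivl"
  by (simp add: carrier_IET is_iet_iff Bij_def)

lemma IET_closed: "f \<in> carrier IET \<Longrightarrow> x \<in> unit_ivl \<Longrightarrow> f x \<in> unit_ivl"
  using bij_betwE[OF IET_bij] by blast

lemma IET_inj: "f \<in> carrier IET \<Longrightarrow> x \<in> unit_ivl \<Longrightarrow> y \<in> unit_ivl \<Longrightarrow> f x = f y \<Longrightarrow> x = y"
  using IET_bij[of f] unfolding bij_betw_def by (meson inj_onD)

lemma IET_ext:
  assumes "f \<in> carrier IET" "g \<in> carrier IET" "\<And>x. x \<in> unit_ivl \<Longrightarrow> f x = g x"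
  shows "f = g"
  using assms by (intro extensionalityI[of f unit_ivl]) (auto simp: carrier_IET is_iet_iff Bij_def)

lemma IET_mult: "f \<in> carrier IET \<Longrightarrow> g \<in> carrier IET \<Longrightarrow> x \<in> unit_ivl \<Longrightarrow> (f \<otimes>\<^bsub>IET\<^esub> g) x = f (g x)"
  by (simp add: IET_def BijGroup_def is_iet_iff compose_def)

lemma IET_one: "x \<in> unit_ivl \<Longrightarrow> \<one>\<^bsub>IET\<^esub> x = x"
  by (simp add: IET_def BijGroup_def)

lemma IET_inv: "f \<in> carrier IET \<Longrightarrow> x \<in> unit_ivl \<Longrightarrow> (inv\<^bsub>IET\<^esub> f) x = inv_into unit_ivl f x"
  using group.m_inv_consistent[OF group_BijGroup iet_subgroup, of f] inv_BijGroup[of f unit_ivl]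
  by (simp add: IET_def is_iet_iff)

lemma IET_inv_f: "f \<in> carrier IET \<Longrightarrow> x \<in> unit_ivl \<Longrightarrow> (inv\<^bsub>IET\<^esub> f) (f x) = x"
  using IET_inv[of f "f x"] IET_closed[of f x] bij_betw_inv_into_left[OF IET_bij] by metis

lemma IET_f_inv: "f \<in> carrier IET \<Longrightarrow> x \<in> unit_ivl \<Longrightarrow> f ((inv\<^bsub>IET\<^esub> f) x) = x"
  using IET_inv[of f x] bij_betw_inv_into_right[OF IET_bij] by metis

lemma IET_inv_eq: "f \<in> carrier IET \<Longrightarrow> x \<in> unit_ivl \<Longrightarrow> f x = y \<Longrightarrow> (inv\<^bsub>IET\<^esub> f) y = x"
  using IET_inv_f by auto

lemma restrict_IET:
  assumes "bij_betw f unit_ivl unit_ivl" "finite A" "translates_off A f"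
  shows "restrict f unit_ivl \<in> carrier IET"
  unfolding carrier_IET is_iet_iff
proof (intro conjI exI)
  show "restrict f unit_ivl \<in> Bij unit_ivl"
    using assms(1) bij_betw_cong[of unit_ivl "restrict f unit_ivl" f unit_ivl] by (simp add: Bij_def)
  show "translates_off A (restrict f unit_ivl)"
    by (rule translates_off_cong[OF assms(3)]) auto
qed (rule assms)

lemma IET_breaks:
  assumes "f \<in> carrier IET" obtains A where "finite A" "translates_off A f"
  using assms by (auto simp: carrier_IET is_iet_iff)

lemma IET_breaks_unit:
  assumes "f \<in> carrier IET"
  obtains A where "finite A" "0 \<in> A" "A \<subseteq> unit_ivl" "translates_off A f"
proof -
  obtain A where A: "finite A" "translates_off A f" using IET_breaks[OF assms] .
  let ?B = "insert 0 (A \<inter> unit_ivl)"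
  have "translates_off ?B f"
  proof (rule translates_offI)
    fix x y :: real assume "0 \<le> x" "x \<le> y" "y < 1" "?B \<inter> {x<..y} = {}"
    then show "f y = f x + (y - x)" by (intro translates_offD[OF A(2)]) auto
  qed
  then show ?thesis using A that[of ?B] by auto
qed

text \<open>An upper bound for the number of break points that is subadditive under composition.\<close>

definition break_bound :: "nat \<Rightarrow> (real \<Rightarrow> real) \<Rightarrow> bool" where
  "break_bound k f \<longleftrightarrow> (\<exists>A. finite A \<and> card A \<le> k \<and> translates_off A f)"

lemma break_bound_mult:
  assumes "f \<in> carrier IET" "g \<in> carrier IET" "break_bound k f" "break_bound l g"
  shows "break_bound (k + l) (f \<otimes>\<^bsub>IET\<^esub> g)"
proof -
  obtain A B where A: "finite A" "card A \<le> k" "translates_off A f"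
    and B: "finite B" "card B \<le> l" "translates_off B g"
    using assms(3,4) by (auto simp: break_bound_def)
  let ?C = "B \<union> inv_into unit_ivl g ` (A \<inter> unit_ivl)"
  have "translates_off ?C (f \<otimes>\<^bsub>IET\<^esub> g)"
    by (rule translates_off_cong[OF translates_off_compose[OF A(3) B(3) IET_bij[OF assms(2)]]])
       (simp add: IET_mult assms)
  moreover have "card ?C \<le> card B + card (inv_into unit_ivl g ` (A \<inter> unit_ivl))" by (rule card_Un_le)
  moreover have "card (inv_into unit_ivl g ` (A \<inter> unit_ivl)) \<le> card A"
    using A by (meson card_image_le card_mono finite_Int inf_le1 le_trans)
  ultimately show ?thesis unfolding break_bound_def
    using A B by (intro exI[of _ ?C]) auto
qed

lemma break_bound_inv:
  assumes "f \<in> carrier IET" "break_bound k f"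
  shows "break_bound (Suc k) (inv\<^bsub>IET\<^esub> f)"
proof -
  obtain A where A: "finite A" "card A \<le> k" "translates_off A f"
    using assms(2) by (auto simp: break_bound_def)
  let ?C = "f ` insert 0 (A \<inter> unit_ivl)"
  have "translates_off ?C (inv\<^bsub>IET\<^esub> f)"
    by (rule translates_off_cong[OF translates_off_inverse[OF A(3,1) IET_bij[OF assms(1)]]])
       (simp add: IET_inv assms)
  moreover have "card ?C \<le> card (insert 0 (A \<inter> unit_ivl))"
    using A by (intro card_image_le) auto
  moreover have "card (insert 0 (A \<inter> unit_ivl)) \<le> Suc (card A)"
    using card_mono[of A "A \<inter> unit_ivl"] A by (simp add: card_insert_if)
  ultimately show ?thesis unfolding break_bound_def
    using A by (intro exI[of _ ?C]) auto
qed

text \<open>The additional point accounts for \<open>0\<close>, which always belongs to \<open>BP f\<close>.\<close>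

lemma IET_uptoI:
  assumes "f \<in> carrier IET" "break_bound k f"
  shows "f \<in> IET_upto (Suc k)"
proof -
  obtain A where A: "finite A" "card A \<le> k" "translates_off A f"
    using assms(2) by (auto simp: break_bound_def)
  have "BP f \<subseteq> insert 0 A"
  proof
    fix x assume x: "x \<in> BP f"
    show "x \<in> insert 0 A"
    proof (rule ccontr)
      assume xA: "x \<notin> insert 0 A"
      then have xI: "x \<in> unit_ivl" and nc: "\<not> continuous (at x within unit_ivl) f"
        using x by (auto simp: BP_def)
      have "open (- A)" using A by (simp add: finite_imp_closed open_Compl)
      then obtain e where e: "e > 0" "ball x e \<subseteq> - A"
        using xA by (metis ComplI insertCI open_contains_ball)
      have tr: "y + (f x - x) = f y" if "y \<in> unit_ivl" "dist y x < e" for y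
      proof (cases "x \<le> y")
        case True
        have "{x<..y} \<subseteq> ball x e" using that by (auto simp: dist_real_def)
        then have "A \<inter> {x<..y} = {}" using e by blast
        then show ?thesis using translates_offD[OF A(3), of x y] True that xI e by auto
      next
        case False
        have "{y<..x} \<subseteq> ball x e" using that by (auto simp: dist_real_def)
        then have "A \<inter> {y<..x} = {}" using e by blast
        then show ?thesis using translates_offD[OF A(3), of y x] False that xI e by auto
      qed
      have "continuous (at x within unit_ivl) (\<lambda>y. y + (f x - x))"
        by (intro continuous_intros)
      then have "continuous (at x within unit_ivl) f"
        by (rule continuous_transform_within[OF _ e(1) xI]) (rule tr)
      then show False using nc by simp
    qed
  qed
  then have "finite (BP f)" "card (BP f) \<le> card (insert 0 A)"
    using A finite_subset[of "BP f" "insert 0 A"] card_mono[of "insert 0 A" "BP f"] by simp_all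
  moreover have "card (insert 0 A) \<le> Suc (card A)" using A by (simp add: card_insert_if)
  ultimately show ?thesis using assms A by (simp add: IET_upto_def)
qed

section \<open>Exchanges of two adjacent intervals generate the group\<close>

text \<open>The exchange of the intervals \<open>[p, p + a)\<close> and \<open>[p + a, p + a + b)\<close>; lengths \<open>0\<close> are allowed and give
  the identity.\<close>

definition swap :: "real \<Rightarrow> real \<Rightarrow> real \<Rightarrow> real \<Rightarrow> real" where
  "swap p a b = (\<lambda>x\<in>unit_ivl. if p \<le> x \<and> x < p + a then x + b
     else if p + a \<le> x \<and> x < p + a + b then x - a else x)"

lemma swap_eq:
  assumes "x \<in> unit_ivl"
  shows "swap p a b x = (if p \<le> x \<and> x < p + a then x + b
     else if p + a \<le> x \<and> x < p + a + b then x - a else x)"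
  using assms by (simp add: swap_def)

lemma
  assumes "0 \<le> p" "0 \<le> a" "0 \<le> b" "p + a + b \<le> 1"
  shows swap_IET: "swap p a b \<in> carrier IET" and swap_break_bound: "break_bound 3 (swap p a b)"
proof -
  have *: "translates_off {p, p + a, p + a + b} (swap p a b)"
    by (rule translates_offI) (auto simp: swap_eq)
  have "bij_betw (swap p a b) unit_ivl unit_ivl"
    by (rule bij_betwI[where g = "swap p b a"]) (use assms in \<open>auto simp: swap_def\<close>)
  from restrict_IET[OF this _ *] show "swap p a b \<in> carrier IET"
    by (simp add: swap_def)
  show "break_bound 3 (swap p a b)" unfolding break_bound_def
    by (intro exI[of _ "{p, p + a, p + a + b}"] conjI *) (auto simp: card_insert_if)
qed

lemma swap_closed:
  assumes "0 \<le> p" "0 \<le> a" "0 \<le> b" "p + a + b \<le> 1" "x \<in> unit_ivl"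
  shows "swap p a b x \<in> unit_ivl"
  using assms by (intro IET_closed[OF swap_IET])

lemma swap_inverse:
  assumes "0 \<le> p" "0 \<le> a" "0 \<le> b" "p + a + b \<le> 1"
  shows "swap p b a \<otimes>\<^bsub>IET\<^esub> swap p a b = \<one>\<^bsub>IET\<^esub>"
proof (rule IET_ext)
  have c: "swap p b a \<in> carrier IET" "swap p a b \<in> carrier IET"
    using assms by (auto intro!: swap_IET)
  then show "swap p b a \<otimes>\<^bsub>IET\<^esub> swap p a b \<in> carrier IET" by simp
  fix x :: real assume x: "x \<in> unit_ivl"
  then show "(swap p b a \<otimes>\<^bsub>IET\<^esub> swap p a b) x = \<one>\<^bsub>IET\<^esub> x"
    using IET_closed[OF c(2) x] assms
    by (auto simp: IET_mult c IET_one swap_eq)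
qed simp

text \<open>If \<open>f\<close> is the identity on \<open>[0, c)\<close>, the interval that \<open>f\<close> moves to \<open>c\<close> can be brought there by one
  exchange of adjacent intervals. The remaining map is the identity on a longer initial interval and
  has one break point less beyond it.\<close>

lemma swap_induct_aux:
  assumes one: "P \<one>\<^bsub>IET\<^esub>"
    and step: "\<And>g p a b. g \<in> carrier IET \<Longrightarrow> P g \<Longrightarrow> 0 \<le> p \<Longrightarrow> 0 \<le> a \<Longrightarrow> 0 \<le> b \<Longrightarrow>
      p + a + b \<le> 1 \<Longrightarrow> P (g \<otimes>\<^bsub>IET\<^esub> swap p a b)"
  shows "f \<in> carrier IET \<Longrightarrow> 0 \<le> c \<Longrightarrow> c \<le> 1 \<Longrightarrow> (\<And>x. 0 \<le> x \<Longrightarrow> x < c \<Longrightarrow> f x = x) \<Longrightarrow>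
    finite A \<Longrightarrow> A \<subseteq> {c..<1} \<Longrightarrow> card A \<le> k \<Longrightarrow> (c < 1 \<Longrightarrow> c \<in> A) \<Longrightarrow> translates_off A f \<Longrightarrow> P f"
proof (induction k arbitrary: f c A)
  case 0
  then have "c = 1" by fastforce
  then have "f = \<one>\<^bsub>IET\<^esub>" using 0 by (intro IET_ext) (auto simp: IET_one)
  then show ?case using one by simp
next
  case (Suc k)
  note f = Suc.prems(1) and c = Suc.prems(2,3) and fixc = Suc.prems(4) and A = Suc.prems(5-8)
    and tr = Suc.prems(9)
  show ?case
  proof (cases "c = 1")
    case True
    then have "f = \<one>\<^bsub>IET\<^esub>" using f fixc by (intro IET_ext) (auto simp: IET_one)
    then show ?thesis using one by simp
  next
    case False
    then have c1: "c < 1" "c \<in> A" using A c by auto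
    obtain u where u: "u \<in> unit_ivl" "f u = c"
      using IET_bij[OF f] c c1 unfolding bij_betw_def
      by (metis (no_types, lifting) atLeastLessThan_iff imageE)
    have uc: "c \<le> u" using fixc[of u] u by force
    \<comment> \<open>Otherwise \<open>f\<close> would be a translation to the left of \<open>u\<close> and take values below \<open>c\<close> there.\<close>
    have uA: "u \<in> A"
    proof (rule ccontr)
      assume nu: "u \<notin> A"
      define S where "S = {b \<in> A. b < u}"
      have "c < u" using nu c1 uc by (cases "c = u") auto
      then have S: "finite S" "c \<in> S" using A c1 by (auto simp: S_def)
      define w where "w = Max S"
      have wS: "w \<in> S" using S unfolding w_def by (intro Max_in) auto
      have max: "b \<le> w" if "b \<in> S" for b using S that by (auto simp: w_def)
      have "c \<le> w" using max S by auto
      have "f u = f w + (u - w)"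
      proof (rule translates_offD[OF tr])
        show "A \<inter> {w<..u} = {}"
        proof (rule ccontr)
          assume "A \<inter> {w<..u} \<noteq> {}"
          then obtain b where b: "b \<in> A" "w < b" "b \<le> u" by auto
          then have "b \<in> S" using nu by (cases "b = u") (auto simp: S_def)
          then show False using max b by force
        qed
      qed (use \<open>c \<le> w\<close> c u wS in \<open>auto simp: S_def\<close>)
      then have fw: "f w < c" using u wS by (auto simp: S_def)
      have wI: "w \<in> unit_ivl" using wS u c \<open>c \<le> w\<close> by (auto simp: S_def)
      have "f (f w) = f w" using fixc fw IET_closed[OF f wI] by auto
      then have "f w = w" using IET_inj[OF f] IET_closed[OF f wI] wI by blast
      then show False using fw \<open>c \<le> w\<close> by auto
    qed
    define v where "v = Min (insert 1 {b \<in> A. u < b})"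
    define g where "g = v - u"
    have fin: "finite (insert 1 {b \<in> A. u < b})" using A by auto
    have vin: "v \<in> insert 1 {b \<in> A. u < b}" unfolding v_def using fin by (intro Min_in) auto
    have vmin: "v \<le> b" if "b \<in> A" "u < b" for b using that fin by (auto simp: v_def)
    have v1: "v \<le> 1" using fin by (simp add: v_def)
    have uv: "u < v" using vin u by auto
    have g: "g > 0" "v = u + g" using uv by (auto simp: g_def)
    define f' where "f' = f \<otimes>\<^bsub>IET\<^esub> swap c g (u - c)"
    have sw: "swap c g (u - c) \<in> carrier IET" "swap c (u - c) g \<in> carrier IET"
      using c g uc v1 by (auto intro!: swap_IET)
    have f': "f' \<in> carrier IET" using f sw by (simp add: f'_def)
    have f'x: "f' x = f (swap c g (u - c) x)" if "x \<in> unit_ivl" for x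
      using that by (simp add: f'_def IET_mult f sw)
    have fu: "f x = c + (x - u)" if "u \<le> x" "x < v" for x
    proof -
      have "A \<inter> {u<..x} = {}" using vmin that by fastforce
      then show ?thesis using translates_offD[OF tr, of u x] u that v1 by auto
    qed
    define A' where "A' = (\<lambda>z. z + g) ` {z \<in> A. z < u} \<union> {z \<in> A. u < z}"
    have A'1: "v \<le> 1" "v < 1 \<Longrightarrow> v \<in> A'" using vin v1 by (auto simp: A'_def)
    have A'2: "c + g < 1 \<Longrightarrow> c + g \<in> A'"
    proof (cases "u = c")
      case True then show "c + g < 1 \<Longrightarrow> c + g \<in> A'" using A'1 g by auto
    next
      case False then show "c + g < 1 \<Longrightarrow> c + g \<in> A'" using c1 uc by (auto simp: A'_def)
    qed
    have "P f'"
    proof (rule Suc.IH[of f' "c + g" A'])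
      show "f' \<in> carrier IET" by (rule f')
      show "0 \<le> c + g" "c + g \<le> 1" using c g v1 uc by auto
      show "finite A'" using A by (auto simp: A'_def)
      have Az: "z \<in> A \<Longrightarrow> c \<le> z \<and> z < 1" for z using A by auto
      show "A' \<subseteq> {c + g..<1}"
      proof
        fix z assume "z \<in> A'"
        then show "z \<in> {c+g..<1}" unfolding A'_def
          using Az vmin g uc v1 by (fastforce)
      qed
      have "card A' \<le> card {z \<in> A. z < u} + card {z \<in> A. u < z}"
        unfolding A'_def using A
        by (intro order_trans[OF card_Un_le] add_mono card_image_le) auto
      also have "\<dots> = card ({z \<in> A. z < u} \<union> {z \<in> A. u < z})"
        using A by (intro card_Un_disjoint[symmetric]) auto
      also have "{z \<in> A. z < u} \<union> {z \<in> A. u < z} = A - {u}" by auto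
      also have "card (A - {u}) \<le> k" using A uA by simp
      finally show "card A' \<le> k" .
      show "c + g < 1 \<Longrightarrow> c + g \<in> A'" by (rule A'2)
      show fx: "f' x = x" if "0 \<le> x" "x < c + g" for x
      proof -
        have xI: "x \<in> unit_ivl" using that g uc v1 by auto
        show ?thesis
        proof (cases "x < c")
          case True
          then show ?thesis using xI fixc that by (auto simp: f'x swap_eq)
        next
          case False
          then have "f' x = f (x + (u - c))" using xI that by (simp add: f'x swap_eq)
          also have "\<dots> = x" using False that g by (subst fu) auto
          finally show ?thesis .
        qed
      qed
      show "translates_off A' f'"
      proof (rule translates_offI)
        fix x y :: real assume *: "0 \<le> x" "x \<le> y" "y < 1" "A' \<inter> {x<..y} = {}"
        have xI: "x \<in> unit_ivl" "y \<in> unit_ivl" using * by auto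
        consider "y < c + g" | "x < c + g" "c + g \<le> y" | "c + g \<le> x" "y < v" | "x < v" "v \<le> y" | "v \<le> x"
          by linarith
        then show "f' y = f' x + (y - x)"
        proof cases
          case 1 then show ?thesis using fx * by auto
        next
          case 2 then show ?thesis using A'2 * by auto
        next
          case 3
          have "f (y - g) = f (x - g) + ((y - g) - (x - g))"
          proof (rule translates_offD[OF tr])
            show "A \<inter> {x - g<..y - g} = {}"
            proof (rule ccontr)
              assume "A \<inter> {x - g<..y - g} \<noteq> {}"
              then obtain b where b: "b \<in> A" "x - g < b" "b \<le> y - g" by auto
              then have "b + g \<in> A'" using 3 g by (auto simp: A'_def)
              then show False using b * by auto
            qed
          qed (use 3 * c g in auto)
          then show ?thesis using 3 * xI g by (simp add: f'x swap_eq)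
        next
          case 4 then show ?thesis using A'1 * by auto
        next
          case 5
          have "f y = f x + (y - x)"
          proof (rule translates_offD[OF tr])
            show "A \<inter> {x<..y} = {}" using * 5 uv unfolding A'_def by fastforce
          qed (use * in auto)
          moreover have "f' x = f x" "f' y = f y" using 5 * xI g uc
            by (simp_all add: f'x swap_eq)
          ultimately show ?thesis by simp
        qed
      qed
    qed
    then have "P (f' \<otimes>\<^bsub>IET\<^esub> swap c (u - c) g)"
      using c g uc v1 by (intro step f') auto
    also have "f' \<otimes>\<^bsub>IET\<^esub> swap c (u - c) g = f"
      using f sw swap_inverse[of c "u - c" g] c g uc v1 unfolding f'_def
      by (simp add: G.m_assoc)
    finally show ?thesis .
  qed
qed

lemma swap_induct [consumes 1, case_names one swap]:
  assumes f: "f \<in> carrier IET" and one: "P \<one>\<^bsub>IET\<^esub>"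
    and step: "\<And>g p a b. g \<in> carrier IET \<Longrightarrow> P g \<Longrightarrow> 0 \<le> p \<Longrightarrow> 0 \<le> a \<Longrightarrow> 0 \<le> b \<Longrightarrow>
      p + a + b \<le> 1 \<Longrightarrow> P (g \<otimes>\<^bsub>IET\<^esub> swap p a b)"
  shows "P f"
proof -
  obtain A where A: "finite A" "0 \<in> A" "A \<subseteq> unit_ivl" "translates_off A f"
    using IET_breaks_unit[OF f] .
  then show ?thesis
    by (intro swap_induct_aux[where P = P and c = 0 and A = A and k = "card A", OF one step f]) auto
qed

section \<open>Rescaled copies\<close>

text \<open>The map that acts on the cell \<open>[j / n, (j + 1) / n)\<close> as the rescaled copy of \<open>d j\<close>, for each \<open>j < n\<close>.\<close>

definition diag :: "nat \<Rightarrow> (nat \<Rightarrow> real \<Rightarrow> real) \<Rightarrow> real \<Rightarrow> real" where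
  "diag n d = (\<lambda>x\<in>unit_ivl. (d (nat \<lfloor>real n * x\<rfloor>) (frac (real n * x)) + \<lfloor>real n * x\<rfloor>) / real n)"

lemma cell_cases:
  assumes "x \<in> unit_ivl" "0 < n"
  obtains j t where "j < n" "t \<in> unit_ivl" "x = (t + real j) / real n"
proof
  have nx: "0 \<le> real n * x" "real n * x < real n" using assms by auto
  then have *: "0 \<le> \<lfloor>real n * x\<rfloor>" "\<lfloor>real n * x\<rfloor> < int n" by (auto simp: floor_less_iff)
  then show "nat \<lfloor>real n * x\<rfloor> < n" by linarith
  show "frac (real n * x) \<in> unit_ivl" by (simp add: frac_lt_1)
  show "x = (frac (real n * x) + real (nat \<lfloor>real n * x\<rfloor>)) / real n"
    using assms(2) *(1) by (subst eq_divide_eq) (auto simp: frac_def mult.commute)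
qed

lemma cell_in:
  assumes "j < n" "t \<in> unit_ivl"
  shows "(t + real j) / real n \<in> unit_ivl"
proof -
  have "real j + 1 \<le> real n" using assms by linarith
  then show ?thesis using assms by (auto simp: field_simps)
qed

lemma diag_cell:
  assumes "j < n" "t \<in> unit_ivl"
  shows "diag n d ((t + real j) / real n) = (d j t + real j) / real n"
proof -
  have "real n * ((t + real j) / real n) = t + real j" using assms by auto
  moreover have "\<lfloor>t + real j\<rfloor> = int j" using assms by (auto simp: floor_eq_iff)
  ultimately show ?thesis
    using cell_in[OF assms] assms by (simp add: diag_def frac_def)
qed

lemma diag_IET:
  assumes n: "0 < n" and d: "\<And>j. j < n \<Longrightarrow> d j \<in> carrier IET"
  shows "diag n d \<in> carrier IET"
proof -
  have bij: "bij_betw (diag n d) unit_ivl unit_ivl"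
  proof (rule bij_betwI[where g = "diag n (\<lambda>j. inv\<^bsub>IET\<^esub> (d j))"])
    show "diag n d \<in> unit_ivl \<rightarrow> unit_ivl"
    proof
      fix x :: real assume "x \<in> unit_ivl"
      with n obtain j t where "j < n" "t \<in> unit_ivl" "x = (t + real j) / real n" by (metis cell_cases)
      then show "diag n d x \<in> unit_ivl"
        using cell_in[of j n "d j t"] IET_closed[OF d, of j t] by (simp only: diag_cell)
    qed
    show "diag n (\<lambda>j. inv\<^bsub>IET\<^esub> (d j)) \<in> unit_ivl \<rightarrow> unit_ivl"
    proof
      fix x :: real assume "x \<in> unit_ivl"
      with n obtain j t where *: "j < n" "t \<in> unit_ivl" "x = (t + real j) / real n" by (metis cell_cases)
      then show "diag n (\<lambda>j. inv\<^bsub>IET\<^esub> (d j)) x \<in> unit_ivl"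
        using cell_in[of j n "(inv\<^bsub>IET\<^esub> (d j)) t"] IET_closed[OF G.inv_closed[OF d], of j t]
        by (simp only: diag_cell)
    qed
    fix x :: real assume "x \<in> unit_ivl"
    with n obtain j t where *: "j < n" "t \<in> unit_ivl" "x = (t + real j) / real n" by (metis cell_cases)
    show "diag n (\<lambda>j. inv\<^bsub>IET\<^esub> (d j)) (diag n d x) = x"
      using * IET_closed[OF d, of j t] by (simp only: diag_cell IET_inv_f d)
    show "diag n d (diag n (\<lambda>j. inv\<^bsub>IET\<^esub> (d j)) x) = x"
      using * IET_closed[OF G.inv_closed[OF d], of j t] by (simp only: diag_cell IET_f_inv d)
  qed
  have "\<forall>j. \<exists>A. j < n \<longrightarrow> finite A \<and> translates_off A (d j)"
    using IET_breaks[OF d] by metis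
  then obtain A where A: "\<And>j. j < n \<Longrightarrow> finite (A j)" "\<And>j. j < n \<Longrightarrow> translates_off (A j) (d j)"
    by metis
  define B where "B = (\<Union>j<n. (\<lambda>a. (a + real j) / real n) ` insert 0 (A j))"
  have "translates_off B (diag n d)"
  proof (rule translates_offI)
    fix x y :: real assume *: "0 \<le> x" "x \<le> y" "y < 1" "B \<inter> {x<..y} = {}"
    obtain j t where x: "j < n" "t \<in> unit_ivl" "x = (t + real j) / real n"
      using cell_cases[of x n] * n by auto
    obtain i s where y: "i < n" "s \<in> unit_ivl" "y = (s + real i) / real n"
      using cell_cases[of y n] * n by auto
    have le: "t + real j \<le> s + real i" using *(2) n x(3) y(3) by (simp add: divide_le_cancel)
    have "i = j"
    proof (rule ccontr)
      assume "i \<noteq> j"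
      moreover have "real j < real i + 1" using le x y by auto
      ultimately have "j < i" by auto
      then have "real j + 1 \<le> real i" by auto
      then have "(0 + real i) / real n \<in> {x<..y}"
        using x y n by (auto simp: divide_strict_right_mono divide_right_mono)
      moreover have "(0 + real i) / real n \<in> B" using y unfolding B_def by blast
      ultimately show False using * by blast
    qed
    have "d j s = d j t + (s - t)"
    proof (rule translates_offD[OF A(2)])
      show "A j \<inter> {t<..s} = {}"
      proof (rule ccontr)
        assume "A j \<inter> {t<..s} \<noteq> {}"
        then obtain b where b: "b \<in> A j" "t < b" "b \<le> s" by auto
        have "(b + real j) / real n \<in> B" using b x unfolding B_def by blast
        moreover have "(b + real j) / real n \<in> {x<..y}"
          using b x y n \<open>i = j\<close> by (auto simp: divide_strict_right_mono divide_right_mono)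
        ultimately show False using * by blast
      qed
    qed (use x y le \<open>i = j\<close> in auto)
    then show "diag n d y = diag n d x + (y - x)"
      using x y n \<open>i = j\<close> by (simp only: diag_cell) (simp add: field_simps)
  qed
  moreover have "finite B" using A by (auto simp: B_def)
  ultimately have "restrict (diag n d) unit_ivl \<in> carrier IET" using bij restrict_IET by blast
  then show ?thesis by (simp add: diag_def)
qed

lemma diag_mult:
  assumes n: "0 < n" and d: "\<And>j. j < n \<Longrightarrow> d j \<in> carrier IET" and e: "\<And>j. j < n \<Longrightarrow> e j \<in> carrier IET"
  shows "diag n d \<otimes>\<^bsub>IET\<^esub> diag n e = diag n (\<lambda>j. d j \<otimes>\<^bsub>IET\<^esub> e j)"
proof (rule IET_ext)
  show "diag n d \<otimes>\<^bsub>IET\<^esub> diag n e \<in> carrier IET" "diag n (\<lambda>j. d j \<otimes>\<^bsub>IET\<^esub> e j) \<in> carrier IET"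
    using assms by (auto intro!: diag_IET)
  fix x :: real assume x: "x \<in> unit_ivl"
  with n obtain j t where *: "j < n" "t \<in> unit_ivl" "x = (t + real j) / real n" by (metis cell_cases)
  have "(diag n d \<otimes>\<^bsub>IET\<^esub> diag n e) x = diag n d (diag n e x)"
    using x assms by (auto intro!: IET_mult diag_IET)
  also have "\<dots> = diag n (\<lambda>j. d j \<otimes>\<^bsub>IET\<^esub> e j) x"
    using * IET_closed[OF e, of j t] by (simp only: diag_cell IET_mult d e)
  finally show "(diag n d \<otimes>\<^bsub>IET\<^esub> diag n e) x = diag n (\<lambda>j. d j \<otimes>\<^bsub>IET\<^esub> e j) x" .
qed

lemma diag_cong: "(\<And>j. j < n \<Longrightarrow> d j = e j) \<Longrightarrow> diag n d = diag n e"
proof (cases "n = 0")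
  case True then show ?thesis by (simp add: diag_def fun_eq_iff)
next
  case False
  assume *: "\<And>j. j < n \<Longrightarrow> d j = e j"
  show ?thesis
  proof
    fix x
    show "diag n d x = diag n e x"
    proof (cases "x \<in> unit_ivl")
      case True
      with False obtain j t where "j < n" "t \<in> unit_ivl" "x = (t + real j) / real n"
        by (metis cell_cases gr0I)
      then show ?thesis using * by (simp only: diag_cell)
    next
      case False
      then show ?thesis by (simp add: diag_def del: atLeastLessThan_iff)
    qed
  qed
qed

lemma diag_one:
  assumes n: "0 < n" shows "diag n (\<lambda>_. \<one>\<^bsub>IET\<^esub>) = \<one>\<^bsub>IET\<^esub>"
proof (rule IET_ext)
  fix x :: real assume x: "x \<in> unit_ivl"
  with n obtain j t where "j < n" "t \<in> unit_ivl" "x = (t + real j) / real n" by (metis cell_cases)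
  then show "diag n (\<lambda>_. \<one>\<^bsub>IET\<^esub>) x = \<one>\<^bsub>IET\<^esub> x" using x by (simp only: diag_cell IET_one)
qed (use n in \<open>auto intro!: diag_IET\<close>)

lemma diag_inv:
  assumes n: "0 < n" and d: "\<And>j. j < n \<Longrightarrow> d j \<in> carrier IET"
  shows "inv\<^bsub>IET\<^esub> (diag n d) = diag n (\<lambda>j. inv\<^bsub>IET\<^esub> (d j))"
proof (rule G.inv_equality)
  have "diag n (\<lambda>j. inv\<^bsub>IET\<^esub> (d j)) \<otimes>\<^bsub>IET\<^esub> diag n d = diag n (\<lambda>j. \<one>\<^bsub>IET\<^esub>)"
    using assms by (subst diag_mult) (auto intro!: diag_cong)
  then show "diag n (\<lambda>j. inv\<^bsub>IET\<^esub> (d j)) \<otimes>\<^bsub>IET\<^esub> diag n d = \<one>\<^bsub>IET\<^esub>" using n by (simp add: diag_one)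
qed (use assms in \<open>auto intro!: diag_IET\<close>)

text \<open>The copy of \<open>f\<close> on \<open>[0, 1 / n)\<close>, extended by the identity.\<close>

definition shrink :: "nat \<Rightarrow> (real \<Rightarrow> real) \<Rightarrow> real \<Rightarrow> real" where
  "shrink n f = diag n (\<lambda>j. if j = 0 then f else \<one>\<^bsub>IET\<^esub>)"

lemma shrink_IET: "0 < n \<Longrightarrow> f \<in> carrier IET \<Longrightarrow> shrink n f \<in> carrier IET"
  by (simp add: shrink_def diag_IET)

lemma shrink_cell:
  "j < n \<Longrightarrow> t \<in> unit_ivl \<Longrightarrow> shrink n f ((t + real j) / real n) = (if j = 0 then f t / real n else (t + real j) / real n)"
  by (simp add: shrink_def diag_cell IET_one)

lemma shrink_hom: "0 < n \<Longrightarrow> shrink n \<in> hom IET IET"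
  by (auto simp: hom_def shrink_IET) (auto simp: shrink_def diag_mult intro!: diag_cong)

lemma shrink_one: "f \<in> carrier IET \<Longrightarrow> shrink 1 f = f"
proof (rule IET_ext)
  fix x :: real assume "x \<in> unit_ivl"
  then show "shrink 1 f x = f x" using shrink_cell[of 0 1 x f] by simp
qed (auto intro!: shrink_IET)

lemma shrink_double:
  assumes n: "0 < n" and f: "f \<in> carrier IET"
  shows "shrink 2 (shrink n f) = shrink (2 * n) f"
proof (rule IET_ext)
  show "shrink 2 (shrink n f) \<in> carrier IET" "shrink (2 * n) f \<in> carrier IET"
    using assms by (auto intro!: shrink_IET)
  fix x :: real assume x: "x \<in> unit_ivl"
  obtain j t where *: "j < 2 * n" "t \<in> unit_ivl" "x = (t + real j) / real (2 * n)"
    using cell_cases[of x "2 * n"] x n by auto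
  show "shrink 2 (shrink n f) x = shrink (2 * n) f x"
  proof (cases "j < n")
    case True
    let ?u = "(t + real j) / real n"
    have "x = (?u + real 0) / real 2" using * by simp
    moreover have "?u \<in> unit_ivl" by (rule cell_in) (use True * in auto)
    ultimately have "shrink 2 (shrink n f) x = shrink n f ?u / 2"
      using shrink_cell[of 0 2 ?u "shrink n f"] by simp
    also have "\<dots> = shrink (2 * n) f x"
      using True * n by (simp only: shrink_cell) (auto simp: field_simps)
    finally show ?thesis .
  next
    case False
    let ?u = "(t + real (j - n)) / real n"
    have xe: "x = (?u + real 1) / real 2" using * False n by (simp add: field_simps of_nat_diff)
    moreover have "?u \<in> unit_ivl" by (rule cell_in) (use False * in auto)
    ultimately have "shrink 2 (shrink n f) ((?u + real 1) / real 2) = (?u + real 1) / real 2"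
      using shrink_cell[of 1 2 ?u "shrink n f"] by simp
    then have "shrink 2 (shrink n f) x = x" by (simp only: xe[symmetric])
    also have "x = shrink (2 * n) f x"
      using False * n by (simp only: shrink_cell) auto
    finally show ?thesis .
  qed
qed

lemma shrink_swap:
  assumes "0 \<le> p" "0 \<le> a" "0 \<le> b" "p + a + b \<le> 1"
  shows "shrink 2 (swap p a b) = swap (p / 2) (a / 2) (b / 2)"
proof (rule IET_ext)
  show "shrink 2 (swap p a b) \<in> carrier IET" "swap (p / 2) (a / 2) (b / 2) \<in> carrier IET"
    using assms by (auto intro!: shrink_IET swap_IET)
  fix x :: real assume x: "x \<in> unit_ivl"
  obtain j t where *: "j < 2" "t \<in> unit_ivl" "x = (t + real j) / real 2"
    using cell_cases[of x 2] x by auto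
  have "shrink 2 (swap p a b) x = (if j = 0 then swap p a b t / 2 else x)"
    using * by (simp only: shrink_cell) auto
  also have "\<dots> = swap (p / 2) (a / 2) (b / 2) x"
  proof (cases "j = 0")
    case True
    then have "x = t / 2" using * by simp
    then show ?thesis using * True x unfolding swap_eq[OF *(2)] swap_eq[OF x] by auto
  next
    case False
    then have "x = (t + 1) / 2" using * by (cases j) auto
    then show ?thesis using * False x assms unfolding swap_eq[OF x] by auto
  qed
  finally show "shrink 2 (swap p a b) x = swap (p / 2) (a / 2) (b / 2) x" .
qed

section \<open>Rescaling and the commutator subgroup\<close>

abbreviation "derived_IET \<equiv> derived IET (carrier IET)"

text \<open>The class of \<open>swap p a b\<close> in the abelianization does not depend on \<open>p\<close>, since a rotation of \<open>[0,1)\<close>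
  conjugates it to \<open>swap 0 a b\<close>, and it is additive in \<open>a\<close> and in \<open>b\<close>. Halving both lengths thus
  divides it by four, and this passes from the generators to all elements.\<close>

lemma derived_shrink_2:
  assumes "f \<in> carrier IET" "shrink 2 f \<in> derived_IET"
  shows "f \<in> derived_IET"
proof -
  define Q where "Q = IET Mod derived_IET"
  define q where "q f = derived_IET #>\<^bsub>IET\<^esub> f" for f
  have nD: "derived_IET \<lhd> IET" by (rule G.derived_self_is_normal)
  interpret Q: comm_group Q unfolding Q_def by (rule G.derived_quot_is_comm_group)
  interpret q: group_hom IET Q q
    unfolding group_hom_def group_hom_axioms_def q_def[abs_def] Q_def
    using group_IET Q.is_group normal.r_coset_hom_Mod[OF nD] by (simp add: Q_def)
  note [simp] = swap_IET
  have pos: "q (swap p a b) = q (swap 0 a b)"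
    if "0 \<le> p" "0 \<le> a" "0 \<le> b" "p + a + b \<le> 1" for p a b
  proof -
    let ?R = "swap 0 p (1 - p)"
    have R: "?R \<in> carrier IET" using that by simp
    have "?R \<otimes>\<^bsub>IET\<^esub> swap p a b = swap 0 a b \<otimes>\<^bsub>IET\<^esub> ?R"
    proof (rule IET_ext)
      fix x :: real assume x: "x \<in> unit_ivl"
      have "swap p a b x \<in> unit_ivl" "?R x \<in> unit_ivl" using x that by (auto intro!: swap_closed simp del: atLeastLessThan_iff)
      then show "(?R \<otimes>\<^bsub>IET\<^esub> swap p a b) x = (swap 0 a b \<otimes>\<^bsub>IET\<^esub> ?R) x"
        using x that by (simp add: IET_mult) (auto simp: swap_eq)
    qed (use that in auto)
    then have "q ?R \<otimes>\<^bsub>Q\<^esub> q (swap p a b) = q (swap 0 a b) \<otimes>\<^bsub>Q\<^esub> q ?R"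
      using that R q.hom_mult[of ?R "swap p a b"] q.hom_mult[of "swap 0 a b" ?R] by simp
    also have "\<dots> = q ?R \<otimes>\<^bsub>Q\<^esub> q (swap 0 a b)" using that R by (intro Q.m_comm) auto
    finally show ?thesis using that R by simp
  qed
  have addl: "q (swap 0 (a + a') b) = q (swap 0 a b) \<otimes>\<^bsub>Q\<^esub> q (swap 0 a' b)"
    if "0 \<le> a" "0 \<le> a'" "0 \<le> b" "a + a' + b \<le> 1" for a a' b
  proof -
    have "swap 0 (a + a') b = swap 0 a b \<otimes>\<^bsub>IET\<^esub> swap a a' b"
    proof (rule IET_ext)
      fix x :: real assume x: "x \<in> unit_ivl"
      have "swap a a' b x \<in> unit_ivl" using x that by (auto intro!: swap_closed simp del: atLeastLessThan_iff)
      then show "swap 0 (a + a') b x = (swap 0 a b \<otimes>\<^bsub>IET\<^esub> swap a a' b) x"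
        using x that by (simp add: IET_mult) (auto simp: swap_eq)
    qed (use that in auto)
    then show ?thesis using that by (simp add: pos[of a])
  qed
  have addr: "q (swap 0 a (b + b')) = q (swap 0 a b) \<otimes>\<^bsub>Q\<^esub> q (swap 0 a b')"
    if "0 \<le> a" "0 \<le> b" "0 \<le> b'" "a + b + b' \<le> 1" for a b b'
  proof -
    have "swap 0 a (b' + b) = swap b' a b \<otimes>\<^bsub>IET\<^esub> swap 0 a b'"
    proof (rule IET_ext)
      fix x :: real assume x: "x \<in> unit_ivl"
      have "swap 0 a b' x \<in> unit_ivl" using x that by (auto intro!: swap_closed simp del: atLeastLessThan_iff)
      then show "swap 0 a (b' + b) x = (swap b' a b \<otimes>\<^bsub>IET\<^esub> swap 0 a b') x"
        using x that by (simp add: IET_mult) (auto simp: swap_eq)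
    qed (use that in auto)
    then show ?thesis using that by (simp add: pos[of b'] add.commute)
  qed
  have quad: "q (swap p a b) = q (swap (p / 2) (a / 2) (b / 2)) [^]\<^bsub>Q\<^esub> (4::nat)"
    if "0 \<le> p" "0 \<le> a" "0 \<le> b" "p + a + b \<le> 1" for p a b
  proof -
    define r where "r = q (swap 0 (a / 2) (b / 2))"
    have r: "r \<in> carrier Q" using that by (simp add: r_def)
    have "q (swap p a b) = q (swap 0 (a / 2 + a / 2) (b / 2 + b / 2))"
      using pos[OF that] by simp
    also have "\<dots> = q (swap 0 (a / 2) (b / 2 + b / 2)) \<otimes>\<^bsub>Q\<^esub> q (swap 0 (a / 2) (b / 2 + b / 2))"
      using that by (intro addl) auto
    also have "q (swap 0 (a / 2) (b / 2 + b / 2)) = r \<otimes>\<^bsub>Q\<^esub> r"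
      unfolding r_def using that by (intro addr) auto
    also have "(r \<otimes>\<^bsub>Q\<^esub> r) \<otimes>\<^bsub>Q\<^esub> (r \<otimes>\<^bsub>Q\<^esub> r) = r [^]\<^bsub>Q\<^esub> (4::nat)"
      using r by (simp add: numeral_eq_Suc Q.m_assoc)
    finally show ?thesis using that pos[of "p / 2" "a / 2" "b / 2"] by (simp add: r_def)
  qed
  have "q f = q (shrink 2 f) [^]\<^bsub>Q\<^esub> (4::nat)"
    using assms(1)
  proof (induction rule: swap_induct)
    case one
    have "shrink 2 \<one>\<^bsub>IET\<^esub> = \<one>\<^bsub>IET\<^esub>" by (simp add: shrink_def diag_one)
    then show ?case by simp
  next
    case (swap g p a b)
    have "shrink 2 (g \<otimes>\<^bsub>IET\<^esub> swap p a b) = shrink 2 g \<otimes>\<^bsub>IET\<^esub> swap (p/2) (a/2) (b/2)"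
      using hom_mult[OF shrink_hom[of 2], of g "swap p a b"] swap by (simp add: shrink_swap)
    then show ?case using swap quad[of p a b] by (simp add: shrink_IET Q.nat_pow_distrib)
  qed
  also have "q (shrink 2 f) = \<one>\<^bsub>Q\<^esub>"
    unfolding q_def Q_def using assms G.derived_is_subgroup[of "carrier IET"]
    by (simp add: FactGroup_def G.coset_join2 shrink_IET subgroup.rcos_const group_IET)
  finally have "q f = \<one>\<^bsub>Q\<^esub>" by (simp only: Q.nat_pow_one)
  moreover have "\<one>\<^bsub>Q\<^esub> = derived_IET" by (simp add: Q_def FactGroup_def)
  ultimately have "q f = derived_IET" by (rule trans)
  then show ?thesis unfolding q_def
    by (intro G.coset_join1[OF _ assms(1)] G.derived_is_subgroup[OF order_refl])
qed

lemma derived_shrink_power_2: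
  assumes "f \<in> carrier IET" "shrink (2 ^ s) f \<in> derived_IET"
  shows "f \<in> derived_IET"
  using assms(2)
proof (induction s)
  case 0
  then show ?case using shrink_one[OF assms(1)] by simp
next
  case (Suc s)
  then have "shrink 2 (shrink (2 ^ s) f) \<in> derived_IET" using assms by (simp add: shrink_double)
  then have "shrink (2 ^ s) f \<in> derived_IET"
    by (rule derived_shrink_2[rotated]) (simp add: shrink_IET assms(1))
  then show ?case by (rule Suc.IH)
qed

section \<open>Commutators on disjoint cells\<close>

abbreviation "commutator f g \<equiv> f \<otimes>\<^bsub>IET\<^esub> g \<otimes>\<^bsub>IET\<^esub> inv\<^bsub>IET\<^esub> f \<otimes>\<^bsub>IET\<^esub> inv\<^bsub>IET\<^esub> g"

lemma foldr_mult:
  assumes "set cs \<subseteq> carrier IET" "x \<in> carrier IET"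
  shows "foldr (\<otimes>\<^bsub>IET\<^esub>) cs x = foldr (\<otimes>\<^bsub>IET\<^esub>) cs \<one>\<^bsub>IET\<^esub> \<otimes>\<^bsub>IET\<^esub> x"
    and "foldr (\<otimes>\<^bsub>IET\<^esub>) cs \<one>\<^bsub>IET\<^esub> \<in> carrier IET"
  using assms by (induction cs) (auto simp: G.m_assoc)

text \<open>With these parameters, \<open>swap\<close> is the rotation of \<open>[0,1)\<close> by \<open>1 / n\<close>, which permutes the \<open>n\<close> cells
  cyclically.\<close>

lemma rot_cell:
  assumes "j < n" "t \<in> unit_ivl"
  shows "swap 0 (1 - 1 / real n) (1 / real n) ((t + real j) / real n) =
    (t + real (if Suc j = n then 0 else Suc j)) / real n"
proof (cases "Suc j = n")
  case True
  then have n: "real n = real j + 1" by simp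
  have e: "1 - 1 / real n = real j / real n" "1 / real n = 1 - real j / real n"
    unfolding n by (simp_all add: field_simps)
  have "(t + real j) / real n \<ge> 1 - 1 / real n" using assms unfolding e by (simp add: divide_right_mono)
  moreover have "(t + real j) / real n \<in> unit_ivl" by (rule cell_in) fact+
  ultimately have "swap 0 (1 - 1 / real n) (1 / real n) ((t + real j) / real n) =
      (t + real j) / real n - (1 - 1 / real n)" by (simp add: swap_eq)
  also have "\<dots> = t / real n" unfolding e by (simp add: add_divide_distrib)
  finally show ?thesis using True by simp
next
  case False
  then have "real j + 2 \<le> real n" using assms by linarith
  have "(t + real j) / real n < (real n - 1) / real n"
    using \<open>real j + 2 \<le> real n\<close> assms by (intro divide_strict_right_mono) auto
  also have "\<dots> = 1 - 1 / real n" using assms by (simp add: diff_divide_distrib)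
  finally have "(t + real j) / real n < 1 - 1 / real n" .
  moreover have "(t + real j) / real n \<in> unit_ivl" by (rule cell_in) fact+
  ultimately show ?thesis using False assms by (auto simp: swap_eq) (simp_all add: field_simps)
qed

lemma rot_diag:
  assumes n: "0 < n" and d: "\<And>j. j < n \<Longrightarrow> d j \<in> carrier IET"
  defines "F \<equiv> swap 0 (1 - 1 / real n) (1 / real n)"
  shows "F \<in> carrier IET"
    and "F \<otimes>\<^bsub>IET\<^esub> diag n d = diag n (\<lambda>j. d (if j = 0 then n - 1 else j - 1)) \<otimes>\<^bsub>IET\<^esub> F"
proof -
  let ?e = "\<lambda>j. d (if j = 0 then n - 1 else j - 1)"
  show F: "F \<in> carrier IET" unfolding F_def using n by (intro swap_IET) auto
  have e: "?e j \<in> carrier IET" if "j < n" for j using that by (intro d) auto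
  note c = diag_IET[of n d, OF n d] diag_IET[of n ?e, OF n e]
  show "F \<otimes>\<^bsub>IET\<^esub> diag n d = diag n ?e \<otimes>\<^bsub>IET\<^esub> F"
  proof (rule IET_ext)
    fix x :: real assume x: "x \<in> unit_ivl"
    with n obtain j t where *: "j < n" "t \<in> unit_ivl" "x = (t + real j) / real n" by (metis cell_cases)
    let ?k = "if Suc j = n then 0 else Suc j"
    have k: "?k < n" using * by auto
    have dt: "d j t \<in> unit_ivl" using d * by (blast intro: IET_closed)
    have "(F \<otimes>\<^bsub>IET\<^esub> diag n d) x = F (diag n d x)" using F c x by (intro IET_mult)
    also have "\<dots> = (d j t + real ?k) / real n"
      using * dt unfolding F_def by (simp only: diag_cell rot_cell)
    also have "d j = ?e ?k" using * by auto
    also have "(?e ?k t + real ?k) / real n = diag n ?e ((t + real ?k) / real n)"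
      using k * by (simp only: diag_cell)
    also have "\<dots> = diag n ?e (F x)"
      using * unfolding F_def by (simp only: rot_cell)
    also have "\<dots> = (diag n ?e \<otimes>\<^bsub>IET\<^esub> F) x" using F c x by (intro IET_mult[symmetric])
    finally show "(F \<otimes>\<^bsub>IET\<^esub> diag n d) x = (diag n ?e \<otimes>\<^bsub>IET\<^esub> F) x" .
  qed (use c F in auto)
qed

text \<open>Let \<open>h\<close> be the product of the commutators \<open>c j = [a j, b j]\<close>, \<open>j < n\<close>. The commutator of the
  diagonal maps with entries \<open>a j\<close> and \<open>b j\<close> has entry \<open>c j\<close> on the \<open>j\<close>-th cell. Multiplying it by the
  commutator of the rotation with the inverse of the diagonal map with entries
  \<open>d j = h\<^sup>-\<^sup>1 c 0 \<cdots> c j\<close> moves all of this to the cell \<open>0\<close>: there the entry becomes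
  \<open>c 0 (d 0)\<^sup>-\<^sup>1 = h\<close>, because \<open>d (n - 1)\<close> is trivial, and on each later cell it becomes
  \<open>c j (d j)\<^sup>-\<^sup>1 (d (j - 1))\<close>, which is trivial.\<close>

lemma shrink_two_commutators:
  assumes cs: "set cs \<subseteq> derived_set IET (carrier IET)" "length cs = n" and n: "0 < n"
  shows "\<exists>u v. u \<in> derived_set IET (carrier IET) \<and> v \<in> derived_set IET (carrier IET) \<and>
    shrink n (foldr (\<otimes>\<^bsub>IET\<^esub>) cs \<one>\<^bsub>IET\<^esub>) = u \<otimes>\<^bsub>IET\<^esub> v"
proof -
  have csc: "set cs \<subseteq> carrier IET" using cs(1) G.derived_set_in_carrier[of "carrier IET"] by blast
  define p where "p j = foldr (\<otimes>\<^bsub>IET\<^esub>) (take j cs) \<one>\<^bsub>IET\<^esub>" for j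
  define h where "h = p n"
  have h: "foldr (\<otimes>\<^bsub>IET\<^esub>) cs \<one>\<^bsub>IET\<^esub> = h" using cs by (simp add: h_def p_def)
  have p: "p j \<in> carrier IET" for j unfolding p_def
    using csc by (intro foldr_mult(2)[of _ "\<one>\<^bsub>IET\<^esub>"]) (auto dest: in_set_takeD)
  have pS: "p (Suc j) = p j \<otimes>\<^bsub>IET\<^esub> cs ! j" if "j < n" for j
  proof -
    have "cs ! j \<in> carrier IET" using that cs csc nth_mem by blast
    moreover have "set (take j cs) \<subseteq> carrier IET" using csc by (auto dest: in_set_takeD)
    ultimately show ?thesis
      using that cs foldr_mult(1)[of "take j cs" "cs ! j"] unfolding p_def
      by (simp add: take_Suc_conv_app_nth)
  qed
  have hc: "h \<in> carrier IET" by (simp add: h_def p)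
  have "\<forall>j. \<exists>a b. j < n \<longrightarrow> a \<in> carrier IET \<and> b \<in> carrier IET \<and> cs ! j = commutator a b"
  proof
    fix j
    show "\<exists>a b. j < n \<longrightarrow> a \<in> carrier IET \<and> b \<in> carrier IET \<and> cs ! j = commutator a b"
    proof (cases "j < n")
      case True
      then have "cs ! j \<in> derived_set IET (carrier IET)" using cs nth_mem by blast
      then show ?thesis by blast
    qed auto
  qed
  then obtain a b where ab: "\<And>j. j < n \<Longrightarrow> a j \<in> carrier IET" "\<And>j. j < n \<Longrightarrow> b j \<in> carrier IET"
    "\<And>j. j < n \<Longrightarrow> cs ! j = commutator (a j) (b j)" by metis
  define d where "d j = inv\<^bsub>IET\<^esub> h \<otimes>\<^bsub>IET\<^esub> p (Suc j)" for j
  have d: "d j \<in> carrier IET" for j using hc p by (simp add: d_def)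
  define F where "F = swap 0 (1 - 1 / real n) (1 / real n)"
  let ?e = "\<lambda>j. d (if j = 0 then n - 1 else j - 1)"
  have F: "F \<in> carrier IET" "F \<otimes>\<^bsub>IET\<^esub> diag n d = diag n ?e \<otimes>\<^bsub>IET\<^esub> F"
    unfolding F_def by (rule rot_diag[OF n d])+
  let ?A = "diag n a" and ?B = "diag n b" and ?P = "diag n d" and ?E = "diag n ?e"
  have c: "?A \<in> carrier IET" "?B \<in> carrier IET" "?P \<in> carrier IET" "?E \<in> carrier IET"
    using n ab d by (auto intro!: diag_IET)
  have 1: "commutator ?A ?B = diag n (\<lambda>j. cs ! j)"
  proof -
    have "commutator ?A ?B = diag n (\<lambda>j. commutator (a j) (b j))"
      using ab n by (simp add: diag_mult diag_inv)
    also have "\<dots> = diag n (\<lambda>j. cs ! j)" using ab by (intro diag_cong) simp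
    finally show ?thesis .
  qed
  have 2: "commutator (inv\<^bsub>IET\<^esub> ?P) F = diag n (\<lambda>j. inv\<^bsub>IET\<^esub> (d j) \<otimes>\<^bsub>IET\<^esub> ?e j)"
  proof -
    have "commutator (inv\<^bsub>IET\<^esub> ?P) F = inv\<^bsub>IET\<^esub> ?P \<otimes>\<^bsub>IET\<^esub> (F \<otimes>\<^bsub>IET\<^esub> ?P) \<otimes>\<^bsub>IET\<^esub> inv\<^bsub>IET\<^esub> F"
      using c F(1) by (simp add: G.m_assoc)
    also have "\<dots> = inv\<^bsub>IET\<^esub> ?P \<otimes>\<^bsub>IET\<^esub> ?E"
      unfolding F(2) using c F(1) by (simp add: G.m_assoc)
    also have "\<dots> = diag n (\<lambda>j. inv\<^bsub>IET\<^esub> (d j) \<otimes>\<^bsub>IET\<^esub> ?e j)"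
      using n d by (simp only: diag_inv) (intro diag_mult; simp)
    finally show ?thesis .
  qed
  have csn: "cs ! j \<in> carrier IET" if "j < n" for j using that cs csc nth_mem by blast
  have lev: "cs ! j \<otimes>\<^bsub>IET\<^esub> (inv\<^bsub>IET\<^esub> (d j) \<otimes>\<^bsub>IET\<^esub> ?e j) = (if j = 0 then h else \<one>\<^bsub>IET\<^esub>)" if j: "j < n" for j
  proof (cases j)
    case 0
    have "p 0 = \<one>\<^bsub>IET\<^esub>" by (simp add: p_def)
    then have "d 0 = inv\<^bsub>IET\<^esub> h \<otimes>\<^bsub>IET\<^esub> cs ! 0" using pS[of 0] n csn[of 0] by (simp add: d_def)
    moreover have "d (n - 1) = \<one>\<^bsub>IET\<^esub>" using n hc by (simp add: d_def h_def[symmetric])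
    ultimately show ?thesis using 0 n hc csn[of 0]
      by (simp add: G.inv_mult_group G.m_assoc[symmetric])
  next
    case (Suc i)
    then have "cs ! j \<otimes>\<^bsub>IET\<^esub> (inv\<^bsub>IET\<^esub> (d j) \<otimes>\<^bsub>IET\<^esub> ?e j) =
       cs ! j \<otimes>\<^bsub>IET\<^esub> (inv\<^bsub>IET\<^esub> (cs ! j) \<otimes>\<^bsub>IET\<^esub> (inv\<^bsub>IET\<^esub> (p j) \<otimes>\<^bsub>IET\<^esub> (h \<otimes>\<^bsub>IET\<^esub> (inv\<^bsub>IET\<^esub> h \<otimes>\<^bsub>IET\<^esub> p j))))"
      using pS[OF j] csn[OF j] hc p by (simp add: d_def G.inv_mult_group G.m_assoc)
    also have "\<dots> = \<one>\<^bsub>IET\<^esub>"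
      using csn[OF j] hc p[of j] by (simp add: G.m_assoc[symmetric])
    finally show ?thesis using Suc by simp
  qed
  have "commutator ?A ?B \<otimes>\<^bsub>IET\<^esub> commutator (inv\<^bsub>IET\<^esub> ?P) F =
      diag n (\<lambda>j. cs ! j \<otimes>\<^bsub>IET\<^esub> (inv\<^bsub>IET\<^esub> (d j) \<otimes>\<^bsub>IET\<^esub> ?e j))"
    unfolding 1 2 using n csn d by (intro diag_mult) auto
  also have "\<dots> = shrink n h"
    unfolding shrink_def by (intro diag_cong lev)
  finally have "shrink n h = commutator ?A ?B \<otimes>\<^bsub>IET\<^esub> commutator (inv\<^bsub>IET\<^esub> ?P) F" ..
  moreover have "commutator ?A ?B \<in> derived_set IET (carrier IET)" using c by blast
  moreover have "commutator (inv\<^bsub>IET\<^esub> ?P) F \<in> derived_set IET (carrier IET)" using c F(1) by blast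
  ultimately show ?thesis unfolding h by blast
qed

section \<open>Moving and rescaling the support\<close>

lemma support_closed:
  assumes f: "f \<in> carrier IET" and fc: "\<And>x. x \<in> unit_ivl \<Longrightarrow> c \<le> x \<Longrightarrow> f x = x"
    and x: "x \<in> unit_ivl" "x < c"
  shows "f x < c"
proof (rule ccontr)
  assume "\<not> f x < c"
  then have "f (f x) = f x" using fc IET_closed[OF f x(1)] by simp
  then have "f x = x" using IET_inj[OF f] IET_closed[OF f x(1)] x by blast
  then show False using x \<open>\<not> f x < c\<close> by simp
qed

lemma shrink_exists:
  assumes h: "h \<in> carrier IET" and n: "0 < n"
    and hc: "\<And>x. x \<in> unit_ivl \<Longrightarrow> 1 / real n \<le> x \<Longrightarrow> h x = x" and k: "break_bound k h"
  shows "\<exists>g\<in>carrier IET. shrink n g = h \<and> break_bound k g"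
proof -
  have nx: "t / real n \<in> unit_ivl" "t / real n < 1 / real n" if "t \<in> unit_ivl" for t
    using that n cell_in[of 0 n t] by (auto simp: divide_strict_right_mono)
  have ih: "inv\<^bsub>IET\<^esub> h \<in> carrier IET" using h by simp
  have ihc: "(inv\<^bsub>IET\<^esub> h) x = x" if "x \<in> unit_ivl" "1 / real n \<le> x" for x
    using IET_inv_eq[OF h that(1)] hc that by blast
  have cl: "real n * f (t / real n) \<in> unit_ivl"
    if f: "f \<in> carrier IET" "\<And>x. x \<in> unit_ivl \<Longrightarrow> 1 / real n \<le> x \<Longrightarrow> f x = x"
      and "t \<in> unit_ivl" for f t
    using support_closed[OF f nx[OF that(3)]] IET_closed[OF f(1) nx(1)[OF that(3)]] n
    by (auto simp: field_simps)
  define g where "g = restrict (\<lambda>t. real n * h (t / real n)) unit_ivl"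
  obtain A where A: "finite A" "card A \<le> k" "translates_off A h"
    using k by (auto simp: break_bound_def)
  let ?A = "(\<lambda>a. real n * a) ` A"
  have tr: "translates_off ?A (\<lambda>t. real n * h (t / real n))"
  proof (rule translates_offI)
    fix x y :: real assume *: "0 \<le> x" "x \<le> y" "y < 1" "?A \<inter> {x<..y} = {}"
    have "h (y / real n) = h (x / real n) + (y / real n - x / real n)"
    proof (rule translates_offD[OF A(3)])
      show "A \<inter> {x / real n<..y / real n} = {}"
      proof (rule ccontr)
        assume "A \<inter> {x / real n<..y / real n} \<noteq> {}"
        then obtain b where "b \<in> A" "x / real n < b" "b \<le> y / real n" by auto
        then have "real n * b \<in> ?A \<inter> {x<..y}" using n by (auto simp: field_simps)
        then show False using * by blast
      qed
      show "y / real n < 1" using nx[of y] * by auto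
    qed (use * in \<open>auto simp: divide_right_mono\<close>)
    then show "real n * h (y / real n) = real n * h (x / real n) + (y - x)"
      using n by (simp add: field_simps)
  qed
  have bij: "bij_betw (\<lambda>t. real n * h (t / real n)) unit_ivl unit_ivl"
  proof (rule bij_betwI[where g = "\<lambda>t. real n * (inv\<^bsub>IET\<^esub> h) (t / real n)"])
    show "(\<lambda>t. real n * h (t / real n)) \<in> unit_ivl \<rightarrow> unit_ivl"
      using cl[OF h hc] by blast
    show "(\<lambda>t. real n * (inv\<^bsub>IET\<^esub> h) (t / real n)) \<in> unit_ivl \<rightarrow> unit_ivl"
      using cl[OF ih ihc] by blast
  qed (use n h nx(1) in \<open>simp_all add: IET_inv_f IET_f_inv del: atLeastLessThan_iff\<close>)
  have g: "g \<in> carrier IET" unfolding g_def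
    using restrict_IET[OF bij _ tr] A by simp
  have "translates_off ?A g" unfolding g_def
    by (rule translates_off_cong[OF tr]) auto
  moreover have "finite ?A" "card ?A \<le> k" using A card_image_le[of A "(*) (real n)"] by auto
  ultimately have "break_bound k g" unfolding break_bound_def by blast
  moreover have "shrink n g = h"
  proof (rule IET_ext)
    fix x :: real assume x: "x \<in> unit_ivl"
    with n obtain j t where *: "j < n" "t \<in> unit_ivl" "x = (t + real j) / real n" by (metis cell_cases)
    have "shrink n g x = (if j = 0 then g t / real n else x)" using * by (simp only: shrink_cell)
    also have "\<dots> = h x"
    proof (cases "j = 0")
      case True
      then show ?thesis using * n by (simp add: g_def del: atLeastLessThan_iff)
    next
      case False
      then have "1 / real n \<le> x" using * n by (auto simp: divide_right_mono)
      then show ?thesis using False hc x by simp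
    qed
    finally show "shrink n g x = h x" .
  qed (use g h n in \<open>auto intro: shrink_IET\<close>)
  ultimately show ?thesis using g by blast
qed

text \<open>The intervals \<open>[a, a + \<delta>)\<close> are moved to the left one after the other, each by one exchange of adjacent
  intervals. The first part of the conclusion guarantees that the target of the next interval does not
  lie to the right of it.\<close>

lemma gather:
  fixes \<delta> :: real
  assumes "0 < \<delta>" "finite A"
  shows "A \<subseteq> {0..} \<Longrightarrow> (\<And>a b. a \<in> A \<Longrightarrow> b \<in> A \<Longrightarrow> a < b \<Longrightarrow> a + \<delta> \<le> b) \<Longrightarrow>
    (\<And>a. a \<in> A \<Longrightarrow> a + \<delta> \<le> 1) \<Longrightarrow>
    (\<forall>c\<ge>0. (\<forall>a\<in>A. a + \<delta> \<le> c) \<longrightarrow> real (card A) * \<delta> \<le> c) \<and>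
    (\<exists>\<phi>\<in>carrier IET. break_bound (3 * card A) \<phi> \<and>
       (\<forall>a\<in>A. \<forall>x\<in>{a..<a + \<delta>}. \<phi> x \<in> {0..<real (card A) * \<delta>}) \<and>
       (\<forall>x\<in>unit_ivl. (\<forall>a\<in>A. a + \<delta> \<le> x) \<longrightarrow> \<phi> x = x))"
  using assms(2)
proof (induction A rule: finite_linorder_max_induct)
  case empty
  have "break_bound 0 \<one>\<^bsub>IET\<^esub>"
    unfolding break_bound_def by (intro exI[of _ "{}"]) (auto simp: IET_one intro!: translates_offI)
  then show ?case by (auto simp: IET_one intro!: bexI[of _ "\<one>\<^bsub>IET\<^esub>"])
next
  case (insert c A)
  have nc: "c \<notin> A" using insert.hyps by auto
  have "A \<subseteq> {0..}" "\<And>a b. a \<in> A \<Longrightarrow> b \<in> A \<Longrightarrow> a < b \<Longrightarrow> a + \<delta> \<le> b" "\<And>a. a \<in> A \<Longrightarrow> a + \<delta> \<le> 1"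
    using insert.prems by auto
  from insert.IH[OF this] obtain \<phi> where
    low: "\<And>c. 0 \<le> c \<Longrightarrow> \<forall>a\<in>A. a + \<delta> \<le> c \<Longrightarrow> real (card A) * \<delta> \<le> c"
    and \<phi>: "\<phi> \<in> carrier IET" "break_bound (3 * card A) \<phi>"
      "\<And>a x. a \<in> A \<Longrightarrow> x \<in> {a..<a + \<delta>} \<Longrightarrow> \<phi> x \<in> {0..<real (card A) * \<delta>}"
      "\<And>x. x \<in> unit_ivl \<Longrightarrow> \<forall>a\<in>A. a + \<delta> \<le> x \<Longrightarrow> \<phi> x = x" by blast
  have c: "0 \<le> c" "c + \<delta> \<le> 1" "\<forall>a\<in>A. a + \<delta> \<le> c" using insert.prems insert.hyps by auto
  define q where "q = real (card A) * \<delta>"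
  have q: "0 \<le> q" "q \<le> c" using low[OF c(1,3)] assms(1) by (auto simp: q_def)
  have card: "real (card (insert c A)) * \<delta> = q + \<delta>"
    using nc insert.hyps by (simp add: q_def algebra_simps)
  define \<rho> where "\<rho> = swap q (c - q) \<delta>"
  have \<rho>: "\<rho> \<in> carrier IET" "break_bound 3 \<rho>"
    unfolding \<rho>_def using q c assms(1) by (auto intro!: swap_IET swap_break_bound)
  have \<rho>x: "(\<rho> \<otimes>\<^bsub>IET\<^esub> \<phi>) x = swap q (c - q) \<delta> (\<phi> x)" if "x \<in> unit_ivl" for x
    using that \<rho> \<phi> by (simp add: IET_mult \<rho>_def)
  have inI: "x \<in> unit_ivl" if "a \<in> insert c A" "x \<in> {a..<a + \<delta>}" for a x
    using that insert.prems by force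
  show ?case
  proof (intro conjI allI impI ballI bexI[of _ "\<rho> \<otimes>\<^bsub>IET\<^esub> \<phi>"])
    show "real (card (insert c A)) * \<delta> \<le> c'" if "0 \<le> c'" "\<forall>a\<in>insert c A. a + \<delta> \<le> c'" for c'
      using that q card by auto
    show "\<rho> \<otimes>\<^bsub>IET\<^esub> \<phi> \<in> carrier IET" using \<rho> \<phi> by simp
    have "break_bound (3 + 3 * card A) (\<rho> \<otimes>\<^bsub>IET\<^esub> \<phi>)" using \<rho> \<phi> by (intro break_bound_mult)
    then show "break_bound (3 * card (insert c A)) (\<rho> \<otimes>\<^bsub>IET\<^esub> \<phi>)"
      using nc insert.hyps by simp
  next
    fix a x assume a: "a \<in> insert c A" "x \<in> {a..<a + \<delta>}"
    have x: "x \<in> unit_ivl" using inI a .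
    show "(\<rho> \<otimes>\<^bsub>IET\<^esub> \<phi>) x \<in> {0..<real (card (insert c A)) * \<delta>}"
    proof (cases "a = c")
      case True
      then have "\<phi> x = x" using a c x by (intro \<phi>(4)) auto
      then show ?thesis using True a q x unfolding \<rho>x[OF x] card by (auto simp: swap_eq)
    next
      case False
      then have "\<phi> x \<in> {0..<q}" using a \<phi>(3) by (auto simp: q_def)
      moreover have "\<phi> x \<in> unit_ivl" using IET_closed \<phi>(1) x by blast
      ultimately show ?thesis using assms(1) q unfolding \<rho>x[OF x] card by (auto simp: swap_eq)
    qed
  next
    fix x assume x: "x \<in> unit_ivl" and *: "\<forall>a\<in>insert c A. a + \<delta> \<le> x"
    then have "\<phi> x = x" by (intro \<phi>(4)) auto
    then show "(\<rho> \<otimes>\<^bsub>IET\<^esub> \<phi>) x = x" using * x q assms(1) unfolding \<rho>x[OF x] by (auto simp: swap_eq)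
  qed
qed

section \<open>Periodic interval exchanges\<close>

text \<open>The distance from \<open>s\<close> to the next point of \<open>S\<close> on its right, or to \<open>1\<close> if there is none. A finite set
  \<open>S\<close> that contains \<open>0\<close> cuts \<open>[0,1)\<close> into the tiles \<open>[s, s + gap S s)\<close>.\<close>

definition gap :: "real set \<Rightarrow> real \<Rightarrow> real" where
  "gap S s = Min (insert 1 {b \<in> S. s < b}) - s"

text \<open>The left end point of the tile that contains \<open>x\<close>.\<close>

definition left_end :: "real set \<Rightarrow> real \<Rightarrow> real" where
  "left_end S x = Max {s \<in> S. s \<le> x}"

text \<open>The finite sets that are the sets of left end points of a tiling of \<open>[0,1)\<close>.\<close>

definition tile_set :: "real set \<Rightarrow> bool" where
  "tile_set S \<longleftrightarrow> finite S \<and> 0 \<in> S \<and> S \<subseteq> unit_ivl"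

lemma gap_ge:
  assumes "finite S" "s + g \<le> 1" "\<And>b. b \<in> S \<Longrightarrow> s < b \<Longrightarrow> s + g \<le> b"
  shows "g \<le> gap S s"
proof -
  have "s + g \<le> Min (insert 1 {b \<in> S. s < b})"
    using assms by (subst Min_ge_iff) auto
  then show ?thesis by (simp add: gap_def)
qed

lemma gap_le:
  assumes "finite S"
  shows "s + gap S s \<le> 1" "b \<in> S \<Longrightarrow> s < b \<Longrightarrow> s + gap S s \<le> b"
  using assms by (auto simp: gap_def)

lemma gap_pos:
  assumes "tile_set S" "s \<in> S"
  shows "0 < gap S s"
proof -
  have "finite (insert 1 {b \<in> S. s < b})" using assms by (simp add: tile_set_def)
  then have "s < Min (insert 1 {b \<in> S. s < b})"
    using assms by (subst Min_gr_iff) (auto simp: tile_set_def)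
  then show ?thesis by (simp add: gap_def)
qed

lemma tile_in:
  assumes "tile_set S" "s \<in> S" "0 \<le> t" "t < gap S s"
  shows "s + t \<in> unit_ivl"
  using assms gap_le(1)[of S s] by (auto simp: tile_set_def)

lemma left_end_tile:
  assumes S: "tile_set S" "s \<in> S" and t: "0 \<le> t" "t < gap S s"
  shows "left_end S (s + t) = s"
proof -
  have "b \<le> s" if "b \<in> S" "b \<le> s + t" for b
    using gap_le(2)[of S b s] that S t by (force simp: tile_set_def)
  then show ?thesis unfolding left_end_def
    using S t by (intro Max_eqI) (auto simp: tile_set_def)
qed

lemma tile_cases:
  assumes "tile_set S" "x \<in> unit_ivl"
  obtains s t where "s \<in> S" "0 \<le> t" "t < gap S s" "x = s + t"
proof
  let ?T = "{s \<in> S. s \<le> x}"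
  have T: "finite ?T" "0 \<in> ?T" using assms by (auto simp: tile_set_def)
  have s: "left_end S x \<in> ?T" unfolding left_end_def using T by (intro Max_in) auto
  show "left_end S x \<in> S" "0 \<le> x - left_end S x" "x = left_end S x + (x - left_end S x)"
    using s by auto
  have "b \<le> left_end S x" if "b \<in> S" "b \<le> x" for b
    unfolding left_end_def using T that by (intro Max_ge) auto
  then have "x < Min (insert 1 {b \<in> S. left_end S x < b})"
    using assms by (subst Min_gr_iff) (force simp: tile_set_def)+
  then show "x - left_end S x < gap S (left_end S x)" by (simp add: gap_def)
qed

lemma translates_off_tiles:
  assumes S: "tile_set S"
    and f1: "\<And>s t. s \<in> S \<Longrightarrow> 0 \<le> t \<Longrightarrow> t < gap S s / 2 \<Longrightarrow> f (s + t) = p s + t"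
    and f2: "\<And>s t. s \<in> S \<Longrightarrow> gap S s / 2 \<le> t \<Longrightarrow> t < gap S s \<Longrightarrow> f (s + t) = q s + t"
  shows "translates_off (S \<union> (\<lambda>s. s + gap S s / 2) ` S) f"
proof (rule translates_offI)
  fix x y :: real assume *: "0 \<le> x" "x \<le> y" "y < 1" and
    dis: "(S \<union> (\<lambda>s. s + gap S s / 2) ` S) \<inter> {x<..y} = {}"
  obtain s t where x: "s \<in> S" "0 \<le> t" "t < gap S s" "x = s + t"
    using tile_cases[OF S, of x] * by auto
  obtain s' t' where y: "s' \<in> S" "0 \<le> t'" "t' < gap S s'" "y = s' + t'"
    using tile_cases[OF S, of y] * by auto
  have "s' \<le> x" using dis y by force
  have fin: "finite S" using S by (simp add: tile_set_def)
  have "s' = s"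
    using gap_le(2)[OF fin x(1), of s'] gap_le(2)[OF fin y(1), of s] \<open>s' \<le> x\<close> x y *(2) by linarith
  have "s + gap S s / 2 \<notin> {x<..y}" using dis x(1) by blast
  then consider "t' < gap S s / 2" | "gap S s / 2 \<le> t" using x y \<open>s' = s\<close> by force
  then show "f y = f x + (y - x)"
  proof cases
    case 1
    then show ?thesis using x y \<open>s' = s\<close> *(2) by (simp add: f1)
  next
    case 2
    then show ?thesis using x y \<open>s' = s\<close> *(2) by (simp add: f2)
  qed
qed

lemma involution_IET:
  assumes "finite A" "translates_off A f"
    and I: "\<And>x. x \<in> unit_ivl \<Longrightarrow> f x \<in> unit_ivl" "\<And>x. x \<in> unit_ivl \<Longrightarrow> f (f x) = x"
  shows "restrict f unit_ivl \<in> carrier IET"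
    and "inv\<^bsub>IET\<^esub> (restrict f unit_ivl) = restrict f unit_ivl"
proof -
  have "bij_betw f unit_ivl unit_ivl"
    by (rule bij_betwI[where g = f]) (use I in \<open>simp_all add: Pi_def del: atLeastLessThan_iff\<close>)
  from restrict_IET[OF this assms(1,2)] show *: "restrict f unit_ivl \<in> carrier IET" .
  show "inv\<^bsub>IET\<^esub> (restrict f unit_ivl) = restrict f unit_ivl"
  proof (rule IET_ext)
    fix x :: real assume "x \<in> unit_ivl"
    then show "(inv\<^bsub>IET\<^esub> (restrict f unit_ivl)) x = restrict f unit_ivl x"
      using I by (intro IET_inv_eq[OF *]) (simp_all del: atLeastLessThan_iff)
  qed (use * in auto)
qed

text \<open>The map that translates each tile so that its left end point \<open>s\<close> goes to \<open>\<pi> s\<close>.\<close>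

definition move_tiles :: "real set \<Rightarrow> (real \<Rightarrow> real) \<Rightarrow> real \<Rightarrow> real" where
  "move_tiles S \<pi> = (\<lambda>x\<in>unit_ivl. \<pi> (left_end S x) + (x - left_end S x))"

lemma move_tiles_tile:
  assumes "tile_set S" "s \<in> S" "0 \<le> t" "t < gap S s"
  shows "move_tiles S \<pi> (s + t) = \<pi> s + t"
  using tile_in[OF assms] left_end_tile[OF assms] by (simp add: move_tiles_def)

text \<open>Let \<open>\<tau>\<close> be the restriction of the given involution to the left halves of the tiles, and let \<open>\<sigma>\<close> exchange
  the halves of every tile. Then \<open>\<sigma> \<tau> \<sigma>\<close> is the restriction to the right halves, and since \<open>\<sigma>\<close> and \<open>\<tau>\<close> are
  involutions, the product \<open>\<tau> \<sigma> \<tau> \<sigma>\<close> is a commutator.\<close>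

lemma tile_involution_commutator:
  assumes S: "tile_set S" and \<pi>: "\<And>s. s \<in> S \<Longrightarrow> \<pi> s \<in> S" "\<And>s. s \<in> S \<Longrightarrow> \<pi> (\<pi> s) = s"
    "\<And>s. s \<in> S \<Longrightarrow> gap S (\<pi> s) = gap S s"
  shows "move_tiles S \<pi> \<in> derived_set IET (carrier IET)"
proof -
  define h where "h s = gap S s / 2" for s
  define \<tau> where "\<tau> x = (let s = left_end S x in if x - s < h s then \<pi> s + (x - s) else x)" for x
  define \<sigma> where "\<sigma> x = (let s = left_end S x in if x - s < h s then x + h s else x - h s)" for x
  let ?B = "S \<union> (\<lambda>s. s + gap S s / 2) ` S"
  have fin: "finite ?B" using S by (auto simp: tile_set_def)
  have h: "0 < h s" "gap S s = 2 * h s" if "s \<in> S" for s using gap_pos[OF S that] by (auto simp: h_def)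
  have h\<pi>: "h (\<pi> s) = h s" if "s \<in> S" for s using \<pi>(3)[OF that] by (simp add: h_def)
  have \<tau>: "\<tau> (s + t) = (if t < h s then \<pi> s + t else s + t)"
    if "s \<in> S" "0 \<le> t" "t < gap S s" for s t
    using left_end_tile[OF S that] by (simp add: \<tau>_def Let_def)
  have \<sigma>: "\<sigma> (s + t) = (if t < h s then s + (t + h s) else s + (t - h s))"
    if "s \<in> S" "0 \<le> t" "t < gap S s" for s t
    using left_end_tile[OF S that] by (simp add: \<sigma>_def Let_def)
  have \<tau>I: "\<tau> x \<in> unit_ivl \<and> \<tau> (\<tau> x) = x" if x: "x \<in> unit_ivl" for x
  proof -
    obtain s t where st: "s \<in> S" "0 \<le> t" "t < gap S s" "x = s + t" using tile_cases[OF S x] .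
    show ?thesis
    proof (cases "t < h s")
      case True
      have "\<tau> (\<pi> s + t) = \<pi> (\<pi> s) + t"
        using \<tau>[of "\<pi> s" t] True st \<pi>[OF st(1)] h\<pi>[OF st(1)] by simp
      then show ?thesis using \<tau>[OF st(1-3)] True st \<pi>[OF st(1)] tile_in[OF S, of "\<pi> s" t]
        by (simp del: atLeastLessThan_iff)
    next
      case False
      then show ?thesis using \<tau>[OF st(1-3)] st x by (simp del: atLeastLessThan_iff)
    qed
  qed
  have \<sigma>I: "\<sigma> x \<in> unit_ivl \<and> \<sigma> (\<sigma> x) = x" if x: "x \<in> unit_ivl" for x
  proof -
    obtain s t where st: "s \<in> S" "0 \<le> t" "t < gap S s" "x = s + t" using tile_cases[OF S x] .
    show ?thesis
    proof (cases "t < h s")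
      case True
      then have "\<sigma> x = s + (t + h s)" "\<sigma> (s + (t + h s)) = s + t"
        using st h[OF st(1)] \<sigma>[OF st(1), of t] \<sigma>[OF st(1), of "t + h s"] by auto
      then show ?thesis using True st h[OF st(1)] tile_in[OF S st(1), of "t + h s"]
        by (simp del: atLeastLessThan_iff)
    next
      case False
      then have "\<sigma> x = s + (t - h s)" "\<sigma> (s + (t - h s)) = s + t"
        using st h[OF st(1)] \<sigma>[OF st(1), of t] \<sigma>[OF st(1), of "t - h s"] by auto
      then show ?thesis using False st h[OF st(1)] tile_in[OF S st(1), of "t - h s"]
        by (simp del: atLeastLessThan_iff)
    qed
  qed
  have tr\<tau>: "translates_off ?B \<tau>"
  proof (rule translates_off_tiles[OF S, where p = "\<pi>" and q = "\<lambda>s. s"])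
    fix s t assume st: "s \<in> S" "0 \<le> t" "t < gap S s / 2"
    then show "\<tau> (s + t) = (\<pi>) s + t"
      using \<tau>[of s t] gap_pos[OF S st(1)] by (simp add: h_def)
  next
    fix s t assume st: "s \<in> S" "gap S s / 2 \<le> t" "t < gap S s"
    then show "\<tau> (s + t) = (\<lambda>s. s) s + t"
      using \<tau>[of s t] gap_pos[OF S st(1)] by (simp add: h_def)
  qed
  have tr\<sigma>: "translates_off ?B \<sigma>"
  proof (rule translates_off_tiles[OF S, where p = "\<lambda>s. s + h s" and q = "\<lambda>s. s - h s"])
    fix s t assume st: "s \<in> S" "0 \<le> t" "t < gap S s / 2"
    then show "\<sigma> (s + t) = (\<lambda>s. s + h s) s + t"
      using \<sigma>[of s t] gap_pos[OF S st(1)] by (simp add: h_def)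
  next
    fix s t assume st: "s \<in> S" "gap S s / 2 \<le> t" "t < gap S s"
    then show "\<sigma> (s + t) = (\<lambda>s. s - h s) s + t"
      using \<sigma>[of s t] gap_pos[OF S st(1)] by (simp add: h_def)
  qed
  have tr\<pi>: "translates_off ?B (move_tiles S \<pi>)"
  proof (rule translates_off_tiles[OF S, where p = "\<pi>" and q = "\<pi>"])
    fix s t assume st: "s \<in> S" "0 \<le> t" "t < gap S s / 2"
    then show "move_tiles S \<pi> (s + t) = (\<pi>) s + t"
      using move_tiles_tile[OF S, of s t \<pi>] gap_pos[OF S st(1)] by (simp add: h_def)
  next
    fix s t assume st: "s \<in> S" "gap S s / 2 \<le> t" "t < gap S s"
    then show "move_tiles S \<pi> (s + t) = (\<pi>) s + t"
      using move_tiles_tile[OF S, of s t \<pi>] gap_pos[OF S st(1)] by (simp add: h_def)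
  qed
  have "restrict (move_tiles S \<pi>) unit_ivl \<in> carrier IET"
  proof (rule involution_IET[OF fin tr\<pi>])
    fix x :: real assume x: "x \<in> unit_ivl"
    obtain s t where st: "s \<in> S" "0 \<le> t" "t < gap S s" "x = s + t" using tile_cases[OF S x] .
    show "move_tiles S \<pi> x \<in> unit_ivl" "move_tiles S \<pi> (move_tiles S \<pi> x) = x"
      using st \<pi>[OF st(1)] tile_in[OF S, of "\<pi> s" t]
      by (simp_all add: move_tiles_tile[OF S] del: atLeastLessThan_iff)
  qed
  then have M: "move_tiles S \<pi> \<in> carrier IET" by (simp add: move_tiles_def)
  define t' where "t' = restrict \<tau> unit_ivl"
  define s' where "s' = restrict \<sigma> unit_ivl"
  have t': "t' \<in> carrier IET" "inv\<^bsub>IET\<^esub> t' = t'"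
    unfolding t'_def using involution_IET[OF fin tr\<tau>] \<tau>I by blast+
  have s': "s' \<in> carrier IET" "inv\<^bsub>IET\<^esub> s' = s'"
    unfolding s'_def using involution_IET[OF fin tr\<sigma>] \<sigma>I by blast+
  have "move_tiles S \<pi> = commutator t' s'"
  proof (rule IET_ext)
    fix x :: real assume x: "x \<in> unit_ivl"
    obtain s t where st: "s \<in> S" "0 \<le> t" "t < gap S s" "x = s + t" using tile_cases[OF S x] .
    have "commutator t' s' x = \<tau> (\<sigma> (\<tau> (\<sigma> x)))"
      using x t' s' \<tau>I \<sigma>I by (simp add: IET_mult t'_def s'_def del: atLeastLessThan_iff)
    also have "\<dots> = \<pi> s + t"
    proof (cases "t < h s")
      case True
      have "\<sigma> x = s + (t + h s)" "\<tau> (s + (t + h s)) = s + (t + h s)" "\<sigma> (s + (t + h s)) = s + t"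
        "\<tau> (s + t) = \<pi> s + t"
        using True st h[OF st(1)] \<sigma>[OF st(1), of t] \<sigma>[OF st(1), of "t + h s"]
          \<tau>[OF st(1), of t] \<tau>[OF st(1), of "t + h s"] by auto
      then show ?thesis by simp
    next
      case False
      have "\<sigma> x = s + (t - h s)" "\<tau> (s + (t - h s)) = \<pi> s + (t - h s)"
        using False st h[OF st(1)] \<sigma>[OF st(1), of t] \<tau>[OF st(1), of "t - h s"] by auto
      moreover have "\<sigma> (\<pi> s + (t - h s)) = \<pi> s + t" "\<tau> (\<pi> s + t) = \<pi> s + t"
        using False st h[OF st(1)] \<pi>[OF st(1)] h\<pi>[OF st(1)]
          \<sigma>[of "\<pi> s" "t - h s"] \<tau>[of "\<pi> s" t] by auto
      ultimately show ?thesis by simp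
    qed
    finally show "move_tiles S \<pi> x = commutator t' s' x" using st by (simp add: move_tiles_tile[OF S])
  qed (use M t' s' in auto)
  then show ?thesis using t' s' by blast
qed

lemma funpow_common_period:
  assumes "finite S" "\<And>s. s \<in> S \<Longrightarrow> \<exists>q>0. (f ^^ q) s = s"
  shows "\<exists>m. \<forall>s\<in>S. (f ^^ Suc m) s = s"
proof -
  obtain q where q: "\<And>s. s \<in> S \<Longrightarrow> 0 < q s" "\<And>s. s \<in> S \<Longrightarrow> (f ^^ q s) s = s"
    using assms(2) by metis
  define N where "N = prod q S"
  have "N > 0" using q by (auto simp: N_def intro: prod_pos)
  have "(f ^^ N) s = s" if "s \<in> S" for s
  proof -
    have "q s dvd N" using assms(1) that by (auto simp: N_def)
    then show ?thesis using funpow_mod_eq[OF q(2)[OF that], of N] by simp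
  qed
  then show ?thesis using \<open>N > 0\<close> by (intro exI[of _ "N - 1"]) auto
qed

text \<open>A permutation \<open>f\<close> of finite order dividing \<open>m + 1\<close> is a product of two involutions that preserve its
  cycles. With a base point \<open>c\<close> on each cycle, the reversal \<open>r\<close> sends \<open>f\<^sup>i c\<close> to \<open>f\<^sup>-\<^sup>i c\<close>, and both \<open>r\<close>
  and \<open>f \<circ> r\<close> are involutions. The inverse of \<open>f\<close> is written as the power \<open>f\<^sup>m\<close>.\<close>

lemma reversal:
  fixes f :: "'a \<Rightarrow> 'a"
  assumes per: "\<And>s. s \<in> S \<Longrightarrow> (f ^^ Suc m) s = s" and cl: "\<And>s. s \<in> S \<Longrightarrow> f s \<in> S"
  shows "\<exists>r. (\<forall>s\<in>S. (\<exists>i. r s = (f ^^ i) s) \<and> r (r s) = s \<and> f (r (f (r s))) = s)"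
proof -
  have clp: "(f ^^ i) s \<in> S" if "s \<in> S" for s i
    using that by (induction i) (auto intro: cl)
  have red: "(f ^^ (a + Suc m * k)) s = (f ^^ a) s" if "s \<in> S" for s a k
  proof (induction k)
    case (Suc k)
    have "(f ^^ (a + Suc m * Suc k)) s = (f ^^ (a + Suc m * k)) ((f ^^ Suc m) s)"
      by (subst comp_apply[symmetric], subst funpow_add[symmetric]) (simp add: algebra_simps)
    then show ?case using Suc per[OF that] by simp
  qed simp
  define b where "b s = (SOME x. x \<in> range (\<lambda>i. (f ^^ i) s))" for s
  have orb: "range (\<lambda>i. (f ^^ i) (f s)) = range (\<lambda>i. (f ^^ i) s)" if "s \<in> S" for s
  proof (intro equalityI subsetI)
    fix x assume "x \<in> range (\<lambda>i. (f ^^ i) (f s))"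
    then obtain i where "x = (f ^^ Suc i) s" by (auto simp: funpow_swap1)
    then show "x \<in> range (\<lambda>i. (f ^^ i) s)" by blast
  next
    fix x assume "x \<in> range (\<lambda>i. (f ^^ i) s)"
    then obtain i where "x = (f ^^ i) s" by auto
    then have "x = (f ^^ (i + Suc m * 1)) s" using red[OF that, of i 1] by simp
    also have "\<dots> = (f ^^ Suc (i + m)) s" by simp
    also have "\<dots> = (f ^^ (i + m)) (f s)" by (simp only: funpow_Suc_right o_apply)
    finally show "x \<in> range (\<lambda>i. (f ^^ i) (f s))" by blast
  qed
  have bf: "b ((f ^^ i) s) = b s" if "s \<in> S" for s i
  proof (induction i)
    case (Suc i)
    then show ?case using orb[OF clp[OF that, of i]] by (simp add: b_def)
  qed simp
  have "\<exists>j. b s = (f ^^ j) s" for s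
    unfolding b_def using someI_ex[of "\<lambda>x. x \<in> range (\<lambda>i. (f ^^ i) s)"] by blast
  then obtain j where j: "\<And>s. b s = (f ^^ j s) s" by metis
  have bS: "b s \<in> S" if "s \<in> S" for s using clp that j by metis
  have bb: "b ((f ^^ i) (b s)) = b s" if "s \<in> S" for s i
    using bf[OF bS[OF that]] bf[OF that, of "j s"] j[of s] by simp
  have "\<exists>i. (f ^^ i) (b s) = s" if "s \<in> S" for s
  proof -
    have "(f ^^ (m * j s)) (b s) = (f ^^ (0 + Suc m * j s)) s"
      unfolding j[of s] by (subst comp_apply[symmetric], subst funpow_add[symmetric]) (simp add: algebra_simps)
    then show ?thesis using red[OF that, of 0 "j s"] by auto
  qed
  then obtain ix where ix: "\<And>s. s \<in> S \<Longrightarrow> (f ^^ ix s) (b s) = s" by metis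
  define r where "r s = (f ^^ (m * ix s)) (b s)" for s
  have r: "r ((f ^^ i) (b s)) = (f ^^ (m * i)) (b s)" if "s \<in> S" for s i
  proof -
    let ?c = "b s" let ?k = "ix ((f ^^ i) ?c)"
    have c: "?c \<in> S" using bS that .
    have eq: "(f ^^ ?k) ?c = (f ^^ i) ?c"
      using ix[OF clp[OF c, of i]] bb[OF that] by simp
    have "(f ^^ (m * ?k)) ?c = (f ^^ (m * ?k + Suc m * i)) ?c" using red[OF c] by simp
    also have "\<dots> = (f ^^ (m * ?k + m * i)) ((f ^^ i) ?c)"
      by (subst comp_apply[symmetric], subst funpow_add[symmetric]) (simp add: algebra_simps)
    also have "\<dots> = (f ^^ (m * ?k + m * i)) ((f ^^ ?k) ?c)" by (simp only: eq)
    also have "\<dots> = (f ^^ (m * i + Suc m * ?k)) ?c"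
      by (subst comp_apply[symmetric], subst funpow_add[symmetric]) (simp add: algebra_simps)
    also have "\<dots> = (f ^^ (m * i)) ?c" using red[OF c] by simp
    finally show ?thesis unfolding r_def bb[OF that] .
  qed
  have mm: "(f ^^ (m * (m * i))) (b s) = (f ^^ i) (b s)" if "s \<in> S" for s i
  proof -
    have c: "b s \<in> S" using bS that .
    have "(f ^^ (m * (m * i))) (b s) = (f ^^ (m * (m * i) + Suc m * i)) (b s)" using red[OF c] by simp
    also have "m * (m * i) + Suc m * i = i + Suc m * (m * i)" by (simp add: algebra_simps)
    also have "(f ^^ (i + Suc m * (m * i))) (b s) = (f ^^ i) (b s)" using red[OF c] by simp
    finally show ?thesis .
  qed
  show ?thesis
  proof (intro exI[of _ r] ballI conjI)
    fix s assume s: "s \<in> S"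
    have rs: "r s = (f ^^ (m * ix s)) (b s)" by (simp add: r_def)
    have "r s = (f ^^ (m * ix s + j s)) s" unfolding rs j[of s] by (simp add: funpow_add)
    then show "\<exists>i. r s = (f ^^ i) s" by blast
    have "r (r s) = (f ^^ ix s) (b s)" unfolding rs using r[OF s] mm[OF s] by simp
    then show "r (r s) = s" using ix[OF s] by simp
    have "f (r s) = (f ^^ Suc (m * ix s)) (b s)" unfolding rs by simp
    then have "f (r (f (r s))) = f ((f ^^ (m * Suc (m * ix s))) (b s))" using r[OF s] by metis
    also have "\<dots> = (f ^^ Suc (m * Suc (m * ix s))) (b s)" by simp
    also have "Suc (m * Suc (m * ix s)) = m * (m * ix s) + Suc m * 1" by simp
    also have "(f ^^ (m * (m * ix s) + Suc m * 1)) (b s) = (f ^^ (m * (m * ix s))) (b s)"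
      by (rule red[OF bS[OF s]])
    also have "\<dots> = s" using mm[OF s] ix[OF s] by simp
    finally show "f (r (f (r s))) = s" .
  qed
qed

lemma funpow_closed:
  "f \<in> carrier IET \<Longrightarrow> x \<in> unit_ivl \<Longrightarrow> (f ^^ i) x \<in> unit_ivl"
  by (induction i) (auto intro: IET_closed simp del: atLeastLessThan_iff)

text \<open>The orbits of the break points form a finite invariant set of left end points of tiles, and \<open>E\<close>
  permutes the tiles, preserving their lengths.\<close>

lemma periodic_two_commutators:
  assumes E: "E \<in> carrier IET" and per: "\<And>x. x \<in> unit_ivl \<Longrightarrow> \<exists>q>0. (E ^^ q) x = x"
  shows "\<exists>u v. u \<in> derived_set IET (carrier IET) \<and> v \<in> derived_set IET (carrier IET) \<and>
    E = u \<otimes>\<^bsub>IET\<^esub> v"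
proof -
  obtain A where A: "finite A" "translates_off A E" using IET_breaks[OF E] .
  define S where "S = (\<Union>a\<in>insert 0 (A \<inter> unit_ivl). range (\<lambda>i. (E ^^ i) a))"
  have finorb: "finite (range (\<lambda>i. (E ^^ i) a))" if a: "a \<in> unit_ivl" for a
  proof -
    obtain q where q: "q > 0" "(E ^^ q) a = a" using per[OF a] by blast
    have "range (\<lambda>i. (E ^^ i) a) \<subseteq> (\<lambda>i. (E ^^ i) a) ` {..<q}"
    proof
      fix x assume "x \<in> range (\<lambda>i. (E ^^ i) a)"
      then obtain i where "x = (E ^^ i) a" by auto
      then have "x = (E ^^ (i mod q)) a" using funpow_mod_eq[OF q(2)] by simp
      then show "x \<in> (\<lambda>i. (E ^^ i) a) ` {..<q}" using q by auto
    qed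
    then show ?thesis using finite_subset by blast
  qed
  have Sin: "(E ^^ i) a \<in> S" if "a \<in> insert 0 (A \<inter> unit_ivl)" for a i
    unfolding S_def using that by blast
  have "0 \<in> S" using Sin[of 0 0] by simp
  moreover have SI: "S \<subseteq> unit_ivl"
  proof
    fix x assume "x \<in> S"
    then obtain a i where "a \<in> insert 0 (A \<inter> unit_ivl)" "x = (E ^^ i) a" unfolding S_def by blast
    then show "x \<in> unit_ivl" using funpow_closed[OF E, of a i] by auto
  qed
  ultimately have S: "tile_set S" unfolding tile_set_def S_def using A finorb by auto
  have AS: "a \<in> S" if "a \<in> A" "a \<in> unit_ivl" for a
    using Sin[of a 0] that by simp
  have ES: "E s \<in> S" if sS: "s \<in> S" for s
  proof -
    obtain a i where "a \<in> insert 0 (A \<inter> unit_ivl)" "s = (E ^^ i) a"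
      using sS unfolding S_def by blast
    then have "E s = (E ^^ Suc i) a" by simp
    then show ?thesis using Sin[OF \<open>a \<in> insert 0 (A \<inter> unit_ivl)\<close>, of "Suc i"] by (simp only:)
  qed
  have ESp: "(E ^^ i) s \<in> S" if "s \<in> S" for s i using that by (induction i) (auto intro: ES)
  have Est: "E (s + t) = E s + t" if st: "s \<in> S" "0 \<le> t" "t < gap S s" for s t
  proof -
    have I: "s + t \<in> unit_ivl" "s \<in> unit_ivl" using tile_in[OF S st] st SI by auto
    have "E (s + t) = E s + (s + t - s)"
    proof (rule translates_offD[OF A(2)])
      show "A \<inter> {s<..s + t} = {}"
      proof (rule ccontr)
        assume "A \<inter> {s<..s + t} \<noteq> {}"
        then obtain a where a: "a \<in> A" "s < a" "a \<le> s + t" by auto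
        then have "a \<in> S" using I by (intro AS) auto
        then show False using gap_le(2)[of S a s] a S st by (auto simp: tile_set_def)
      qed
    qed (use I st in auto)
    then show ?thesis by simp
  qed
  have pre: "x \<in> S" if x: "x \<in> unit_ivl" "E x \<in> S" for x
  proof -
    obtain q where q: "q > 0" "(E ^^ q) x = x" using per[OF x(1)] by blast
    then have "(E ^^ (q - 1)) (E x) = x"
      by (metis One_nat_def Suc_pred funpow_Suc_right o_apply)
    then show ?thesis using ESp[OF x(2), of "q - 1"] by simp
  qed
  \<comment> \<open>Tiles cannot become shorter under \<open>E\<close>; by periodicity they keep their length.\<close>
  have gap1: "gap S s \<le> gap S (E s)" if s: "s \<in> S" for s
  proof (rule gap_ge)
    show "finite S" using S by (simp add: tile_set_def)
    show "E s + gap S s \<le> 1"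
    proof (rule field_le_epsilon)
      fix e :: real assume e: "0 < e"
      define t where "t = max 0 (gap S s - e)"
      have t: "0 \<le> t" "t < gap S s" using gap_pos[OF S s] e by (auto simp: t_def)
      have "E (s + t) < 1" using IET_closed[OF E tile_in[OF S s t]] by simp
      then show "E s + gap S s \<le> 1 + e" using Est[OF s t] by (auto simp: t_def)
    qed
    show "E s + gap S s \<le> b" if b: "b \<in> S" "E s < b" for b
    proof (rule ccontr)
      assume "\<not> E s + gap S s \<le> b"
      define t where "t = b - E s"
      have t: "0 < t" "t < gap S s" using b \<open>\<not> E s + gap S s \<le> b\<close> by (auto simp: t_def)
      have "E (s + t) = b" using Est[OF s, of t] t by (simp add: t_def)
      then have "s + t \<in> S" using pre tile_in[OF S s, of t] t b by auto
      then have "s + gap S s \<le> s + t" using gap_le(2)[of S "s + t" s] S t by (auto simp: tile_set_def)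
      then show False using t by simp
    qed
  qed
  have gapi: "gap S s \<le> gap S ((E ^^ i) s)" if s: "s \<in> S" for s i
  proof (induction i)
    case (Suc i)
    then show ?case using gap1[OF ESp[OF s, of i]] by simp
  qed simp
  have gapE: "gap S (E s) = gap S s" if s: "s \<in> S" for s
  proof -
    obtain q where q: "q > 0" "(E ^^ q) s = s" using per s SI by blast
    have "gap S (E s) \<le> gap S ((E ^^ (q - 1)) (E s))" by (rule gapi[OF ES[OF s]])
    also have "(E ^^ (q - 1)) (E s) = s"
      using q by (metis One_nat_def Suc_pred funpow_Suc_right o_apply)
    finally show ?thesis using gap1[OF s] by simp
  qed
  have gapEp: "gap S ((E ^^ i) s) = gap S s" if s: "s \<in> S" for s i
    by (induction i) (auto simp: gapE ESp[OF s])
  obtain m where "\<forall>s\<in>S. (E ^^ Suc m) s = s"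
    using funpow_common_period[of S E] S per SI by (metis subsetD tile_set_def)
  then obtain r where r: "\<And>s. s \<in> S \<Longrightarrow> \<exists>i. r s = (E ^^ i) s" "\<And>s. s \<in> S \<Longrightarrow> r (r s) = s"
      "\<And>s. s \<in> S \<Longrightarrow> E (r (E (r s))) = s"
    using reversal[where S = S and f = E and m = m] ES by blast
  have rS: "r s \<in> S" "gap S (r s) = gap S s" if "s \<in> S" for s
    using r(1)[OF that] ESp[OF that] gapEp[OF that] by auto
  define v where "v = move_tiles S r"
  define u where "u = move_tiles S (\<lambda>s. E (r s))"
  have v: "v \<in> derived_set IET (carrier IET)"
    unfolding v_def using r rS by (intro tile_involution_commutator[OF S]) auto
  have u: "u \<in> derived_set IET (carrier IET)"
    unfolding u_def using r rS by (intro tile_involution_commutator[OF S]) (auto simp: gapE ES)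
  have uv: "u \<in> carrier IET" "v \<in> carrier IET"
    using u v G.derived_set_in_carrier[of "carrier IET"] by blast+
  have "E = u \<otimes>\<^bsub>IET\<^esub> v"
  proof (rule IET_ext)
    fix x :: real assume x: "x \<in> unit_ivl"
    obtain s t where st: "s \<in> S" "0 \<le> t" "t < gap S s" "x = s + t" using tile_cases[OF S x] .
    have "(u \<otimes>\<^bsub>IET\<^esub> v) x = u (v x)" using uv x by (intro IET_mult)
    also have "v x = r s + t" using st by (simp add: v_def move_tiles_tile[OF S])
    also have "u (r s + t) = E (r (r s)) + t"
      using st rS[OF st(1)] unfolding u_def by (subst move_tiles_tile[OF S]) auto
    also have "\<dots> = E x" using st r(2)[OF st(1)] Est by simp
    finally show "E x = (u \<otimes>\<^bsub>IET\<^esub> v) x" ..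
  qed (use E uv in auto)
  then show ?thesis using u v by blast
qed

section \<open>First return maps\<close>

text \<open>Two points of the orbit have distance at most \<open>\<delta>\<close>. If they differ by \<open>d\<close>, then the power of \<open>g\<close> that
  moves one to the other keeps translating by \<open>d\<close> along the orbit, which is impossible in a bounded set
  unless \<open>d = 0\<close>.\<close>

lemma translated_orbit_periodic:
  fixes g :: "real \<Rightarrow> real"
  assumes inj: "inj_on g unit_ivl" and cl: "\<And>x. x \<in> unit_ivl \<Longrightarrow> g x \<in> unit_ivl"
    and y: "y \<in> unit_ivl" and \<delta>: "0 < \<delta>"
    and tr: "\<And>k s. 0 \<le> s \<Longrightarrow> s \<le> \<delta> \<Longrightarrow> g ((g ^^ k) y - s) = g ((g ^^ k) y) - s"
  shows "\<exists>p>0. (g ^^ p) y = y"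
proof -
  have I: "(g ^^ k) y \<in> unit_ivl" for k using y by (induction k) (simp_all add: cl del: atLeastLessThan_iff)
  have trp: "(g ^^ p) ((g ^^ k) y - s) = (g ^^ p) ((g ^^ k) y) - s" if "0 \<le> s" "s \<le> \<delta>" for p k s
  proof (induction p)
    case (Suc p)
    have "(g ^^ Suc p) ((g ^^ k) y - s) = g ((g ^^ (p + k)) y - s)"
      using Suc by (simp add: funpow_add)
    then show ?case using tr[OF that, of "p + k"] by (simp add: funpow_add)
  qed simp
  define c where "c k = \<lfloor>(g ^^ k) y / \<delta>\<rfloor>" for k
  have "0 \<le> c k" "c k \<le> \<lfloor>1 / \<delta>\<rfloor>" for k
    unfolding c_def using I[of k] \<delta> by (auto intro!: floor_mono divide_right_mono)
  then have "range c \<subseteq> {0..\<lfloor>1 / \<delta>\<rfloor>}" by auto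
  then have "finite (range c)" using finite_subset by blast
  then have "\<not> inj c" using finite_imageD infinite_UNIV_nat by blast
  then obtain i j where ij: "i < j" "c i = c j" unfolding inj_def by (metis linorder_neqE_nat)
  define u where "u = (g ^^ i) y"
  define p where "p = j - i"
  define d where "d = (g ^^ p) u - u"
  have p: "p > 0" using ij by (simp add: p_def)
  have gp: "(g ^^ p) u = (g ^^ j) y" using ij unfolding u_def p_def
    by (subst comp_apply[symmetric], subst funpow_add[symmetric]) simp
  have "\<lfloor>u / \<delta>\<rfloor> = \<lfloor>(g ^^ p) u / \<delta>\<rfloor>"
    using ij gp by (simp add: c_def u_def)
  then have "\<bar>(g ^^ p) u / \<delta> - u / \<delta>\<bar> < 1"
    by linarith
  then have "\<bar>d\<bar> / \<delta> < 1" using \<delta> by (simp add: d_def diff_divide_distrib[symmetric])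
  then have d: "\<bar>d\<bar> \<le> \<delta>" using \<delta> by simp
  have step: "(g ^^ (p * k)) u = u + real k * d" for k
  proof -
    have stepd: "(g ^^ p) ((g ^^ (p * k)) u) = (g ^^ (p * k)) u + d" for k
    proof (induction k)
      case (Suc k)
      let ?v = "(g ^^ (p * k)) u" and ?w = "(g ^^ (p * Suc k)) u"
      have w: "?w = (g ^^ p) ?v" by (simp add: funpow_add)
      then have wv: "?w = ?v + d" using Suc by simp
      have vy: "?v = (g ^^ (p * k + i)) y" "?w = (g ^^ (p * Suc k + i)) y" by (simp_all add: u_def funpow_add)
      show ?case
      proof (cases "d \<le> 0")
        case True
        have "(g ^^ p) (?v - (- d)) = (g ^^ p) ?v - (- d)"
          unfolding vy(1) by (rule trp) (use True d in auto)
        then show ?thesis using wv w by simp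
      next
        case False
        have "(g ^^ p) (?w - d) = (g ^^ p) ?w - d"
          unfolding vy(2) by (rule trp) (use False d in auto)
        moreover have "?w - d = ?v" using wv by simp
        ultimately have "(g ^^ p) ?v = (g ^^ p) ?w - d" by (simp only:)
        then show ?thesis using w by linarith
      qed
    qed (simp add: d_def)
    show ?thesis
    proof (induction k)
      case (Suc k)
      have "(g ^^ (p * Suc k)) u = (g ^^ p) ((g ^^ (p * k)) u)" by (simp add: funpow_add)
      also have "\<dots> = (g ^^ (p * k)) u + d" by (rule stepd)
      also have "\<dots> = u + real k * d + d" by (simp only: Suc)
      finally show ?case by (simp add: algebra_simps)
    qed simp
  qed
  have "d = 0"
  proof (rule ccontr)
    assume "d \<noteq> 0"
    then obtain k :: nat where k: "real k * \<bar>d\<bar> > 1"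
      using reals_Archimedean3[of "\<bar>d\<bar>"] by auto
    have "(g ^^ (p * k)) u = (g ^^ (p * k + i)) y" by (simp add: u_def funpow_add)
    then have "u + real k * d \<in> unit_ivl" using I[of "p * k + i"] step[of k] by simp
    moreover have "u \<in> unit_ivl" using I[of i] by (simp add: u_def)
    ultimately have "\<bar>real k * d\<bar> < 1" by auto
    then show False using k by (simp add: abs_mult)
  qed
  then have "(g ^^ i) ((g ^^ p) y) = (g ^^ i) y"
    unfolding d_def u_def by (metis comp_apply eq_iff_diff_eq_0 funpow_add add.commute)
  moreover have "inj_on (g ^^ i) unit_ivl"
  proof (induction i)
    case (Suc i)
    have "(g ^^ i) ` unit_ivl \<subseteq> unit_ivl"
    proof -
      have "(g ^^ i) x \<in> unit_ivl" if "x \<in> unit_ivl" for x i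
        using that by (induction i) (simp_all add: cl del: atLeastLessThan_iff)
      then show ?thesis by blast
    qed
    then have "inj_on g ((g ^^ i) ` unit_ivl)" using inj inj_on_subset by blast
    with Suc show ?case unfolding funpow.simps by (rule comp_inj_on)
  qed simp
  ultimately have "(g ^^ p) y = y" using I[of p] y by (meson inj_onD)
  then show ?thesis using p by blast
qed

text \<open>A point \<open>u\<close> outside \<open>K\<close> has distance at least \<open>\<delta>\<close> from the break point to its left, so \<open>f\<close> is a
  translation on \<open>[u - \<delta>, u]\<close>; thus an orbit that avoids \<open>K\<close> is periodic. Applied to \<open>f\<close> this makes
  the return time to \<open>K\<close> finite, applied to \<open>f\<^sup>-\<^sup>1\<close> it makes the first return map \<open>h\<close> surjective on \<open>K\<close>. The
  break points of \<open>h\<close> are the end points of the intervals of \<open>K\<close> and, for each of these end points, at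
  most one point of \<open>K\<close> whose orbit reaches it before or upon its first return.\<close>

lemma first_return_decomposition:
  assumes f: "f \<in> carrier IET" and A: "finite A" "0 \<in> A" "A \<subseteq> unit_ivl" "translates_off A f"
    and \<delta>: "0 < \<delta>" and sep: "\<And>a b. a \<in> A \<Longrightarrow> b \<in> A \<Longrightarrow> a < b \<Longrightarrow> a + \<delta> \<le> b"
  shows "\<exists>h E. h \<in> carrier IET \<and> E \<in> carrier IET \<and> f = h \<otimes>\<^bsub>IET\<^esub> E \<and>
    break_bound (4 * card A) h \<and>
    (\<forall>x\<in>unit_ivl. x \<notin> (\<Union>a\<in>A. {a..<a + \<delta>}) \<longrightarrow> h x = x) \<and>
    (\<forall>x\<in>unit_ivl. \<exists>q>0. (E ^^ q) x = x)"
proof -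
  define K where "K = unit_ivl \<inter> (\<Union>a\<in>A. {a..<a + \<delta>})"
  define B where "B = A \<union> (\<lambda>a. a + \<delta>) ` A"
  define g where "g = inv\<^bsub>IET\<^esub> f"
  have g: "g \<in> carrier IET" using f by (simp add: g_def)
  have gf: "g (f x) = x" and fg: "f (g x) = x" if "x \<in> unit_ivl" for x
    using that f by (simp_all add: g_def IET_inv_f IET_f_inv)
  note clf = funpow_closed[OF f] and clg = funpow_closed[OF g]
  have fgp: "(f ^^ k) ((g ^^ k) x) = x" "(g ^^ k) ((f ^^ k) x) = x" if "x \<in> unit_ivl" for x k
  proof -
    show "(f ^^ k) ((g ^^ k) x) = x"
    proof (induction k)
      case (Suc k)
      have "(f ^^ Suc k) ((g ^^ Suc k) x) = (f ^^ k) (f (g ((g ^^ k) x)))" by (simp add: funpow_swap1)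
      then show ?case using fg[OF clg[OF that]] Suc by simp
    qed simp
    show "(g ^^ k) ((f ^^ k) x) = x"
    proof (induction k)
      case (Suc k)
      have "(g ^^ Suc k) ((f ^^ Suc k) x) = (g ^^ k) (g (f ((f ^^ k) x)))" by (simp add: funpow_swap1)
      then show ?case using gf[OF clf[OF that]] Suc by simp
    qed simp
  qed
  have KI: "x \<in> unit_ivl" if "x \<in> K" for x using that by (simp add: K_def)
  \<comment> \<open>\<open>f\<close> is a translation on an interval of length \<open>\<delta>\<close> to the left of a point outside \<open>K\<close>.\<close>
  have left: "0 \<le> u - s \<and> f (u - s) = f u - s" if u: "u \<in> unit_ivl" "u \<notin> K" and s: "0 \<le> s" "s \<le> \<delta>" for u s
  proof -
    define a where "a = Max {a \<in> A. a \<le> u}"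
    have fin: "finite {a \<in> A. a \<le> u}" using A by simp
    have "a \<in> {a \<in> A. a \<le> u}" unfolding a_def using A u by (intro Max_in) auto
    then have a: "a \<in> A" "a \<le> u" by auto
    have amax: "b \<le> a" if "b \<in> A" "b \<le> u" for b unfolding a_def using fin that by (intro Max_ge) auto
    have "a + \<delta> \<le> u" using u a by (force simp: K_def)
    then have us: "a \<le> u - s" using s by simp
    moreover have "0 \<le> a" using a A by auto
    moreover have "f u = f (u - s) + (u - (u - s))"
    proof (rule translates_offD[OF A(4)])
      show "A \<inter> {u - s<..u} = {}" using amax us by force
    qed (use s u us \<open>0 \<le> a\<close> in auto)
    ultimately show ?thesis by auto
  qed
  have per_f: "\<exists>p>0. (f ^^ p) x = x" if x: "x \<in> unit_ivl" "\<And>k. (f ^^ k) x \<notin> K" for x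
  proof (rule translated_orbit_periodic[OF _ _ x(1) \<delta>])
    show "inj_on f unit_ivl" using IET_bij[OF f] by (simp add: bij_betw_def)
    show "f z \<in> unit_ivl" if "z \<in> unit_ivl" for z using IET_closed[OF f that] .
    show "f ((f ^^ k) x - s) = f ((f ^^ k) x) - s" if "0 \<le> s" "s \<le> \<delta>" for k s
      using left[OF clf[OF x(1)] x(2) that] by simp
  qed
  have per_g: "\<exists>p>0. (g ^^ p) x = x" if x: "x \<in> unit_ivl" "\<And>k. 0 < k \<Longrightarrow> (g ^^ k) x \<notin> K" for x
  proof (rule translated_orbit_periodic[OF _ _ x(1) \<delta>])
    show "inj_on g unit_ivl" using IET_bij[OF g] by (simp add: bij_betw_def)
    show "g z \<in> unit_ivl" if "z \<in> unit_ivl" for z using IET_closed[OF g that] .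
    show "g ((g ^^ k) x - s) = g ((g ^^ k) x) - s" if s: "0 \<le> s" "s \<le> \<delta>" for k s
    proof -
      let ?u = "(g ^^ Suc k) x"
      have "0 \<le> ?u - s" "f (?u - s) = f ?u - s"
        using left[OF clg[OF x(1)] x(2) s, of "Suc k"] by auto
      moreover have uI: "?u \<in> unit_ivl" using clg[OF x(1)] .
      moreover have "f ?u = (g ^^ k) x" using fg[OF clg[OF x(1), of k]] by simp
      moreover have "?u - s \<in> unit_ivl" using calculation s by auto
      ultimately have "g ((g ^^ k) x - s) = ?u - s" using gf[of "?u - s"] by simp
      then show ?thesis by simp
    qed
  qed
  have per_gf: "(f ^^ p) x = x" if "x \<in> unit_ivl" "(g ^^ p) x = x" for x p
    using fgp(1)[OF that(1), of p] that by simp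
  have rec: "\<exists>n>0. (f ^^ n) x \<in> K" if x: "x \<in> K" for x
  proof (rule ccontr)
    assume no: "\<not> (\<exists>n>0. (f ^^ n) x \<in> K)"
    have xI: "x \<in> unit_ivl" using KI x .
    have "(f ^^ k) (f x) \<notin> K" for k
      using no by (metis funpow_Suc_right o_apply zero_less_Suc)
    then obtain p where p: "p > 0" "(f ^^ p) (f x) = f x"
      using per_f[OF IET_closed[OF f xI]] by blast
    have "f ((f ^^ p) x) = f x" using p(2) by (simp add: funpow_swap1)
    then have "(f ^^ p) x = x" using IET_inj[OF f clf[OF xI] xI] by blast
    moreover have "(f ^^ p) x \<notin> K" using no p by blast
    ultimately show False using x by simp
  qed
  \<comment> \<open>The return time to \<open>K\<close>.\<close>
  define n where "n x = (LEAST n. 0 < n \<and> (f ^^ n) x \<in> K)" for x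
  have n: "0 < n x" "(f ^^ n x) x \<in> K" if "x \<in> K" for x
    using LeastI_ex[OF rec[OF that]] by (auto simp: n_def)
  have nmin: "(f ^^ k) x \<notin> K" if "0 < k" "k < n x" for x k
    using not_less_Least[of k "\<lambda>n. 0 < n \<and> (f ^^ n) x \<in> K"] that by (auto simp: n_def)
  have nI: "n x = k"
    if k: "0 < k" "(f ^^ k) x \<in> K" and prev: "\<And>j. 0 < j \<Longrightarrow> j < k \<Longrightarrow> (f ^^ j) x \<notin> K" for x k
    unfolding n_def
  proof (rule Least_equality)
    show "0 < k \<and> (f ^^ k) x \<in> K" using k by simp
    fix j assume "0 < j \<and> (f ^^ j) x \<in> K"
    then show "k \<le> j" using prev by (meson not_le)
  qed
  define h0 where "h0 x = (if x \<in> K then (f ^^ n x) x else x)" for x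
  have h0K: "h0 x \<in> K" if "x \<in> K" for x using that n by (simp add: h0_def)
  have hit: "\<exists>z i. z \<in> K \<and> i < n z \<and> x = (f ^^ i) z" if x: "x \<in> unit_ivl" "(g ^^ k) x \<in> K" for x k
  proof -
    define i where "i = (LEAST k. (g ^^ k) x \<in> K)"
    have i: "(g ^^ i) x \<in> K" unfolding i_def by (rule LeastI[of _ k]) (rule x(2))
    have im: "(g ^^ j) x \<notin> K" if "j < i" for j using not_less_Least that by (auto simp: i_def)
    let ?z = "(g ^^ i) x"
    have fz: "(f ^^ j) ?z = (g ^^ (i - j)) x" if "j \<le> i" for j
    proof -
      have "(g ^^ i) x = (g ^^ j) ((g ^^ (i - j)) x)"
        using that by (subst comp_apply[symmetric], subst funpow_add[symmetric]) simp
      then show ?thesis using fgp(1)[OF clg[OF x(1)]] by simp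
    qed
    have "\<not> n ?z \<le> i"
    proof
      assume "n ?z \<le> i"
      then have "(g ^^ (i - n ?z)) x \<in> K" using n(2)[OF i] fz by simp
      then show False using im[of "i - n ?z"] n(1)[OF i] \<open>n ?z \<le> i\<close> by simp
    qed
    then show ?thesis using i fz[of i] by (intro exI[of _ ?z] exI[of _ i]) auto
  qed
  have inj: "inj_on h0 K"
  proof -
    have *: "x = y" if xy: "x \<in> K" "y \<in> K" "h0 x = h0 y" "n x \<le> n y" for x y
    proof -
      let ?d = "n y - n x"
      have "(f ^^ n y) y = (f ^^ n x) ((f ^^ ?d) y)"
        using xy by (subst comp_apply[symmetric], subst funpow_add[symmetric]) simp
      then have "(f ^^ n x) ((f ^^ ?d) y) = (f ^^ n x) x" using xy by (simp add: h0_def)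
      then have "(g ^^ n x) ((f ^^ n x) ((f ^^ ?d) y)) = (g ^^ n x) ((f ^^ n x) x)" by simp
      then have e: "(f ^^ ?d) y = x" using fgp(2)[OF clf[OF KI[OF xy(2)]]] fgp(2)[OF KI[OF xy(1)]] by simp
      have "?d < n y" using n(1)[OF xy(1)] xy(4) by simp
      then have "\<not> 0 < ?d" using nmin[of ?d y] e xy(1) by metis
      then have "?d = 0" by simp
      then show ?thesis using e by (simp only: funpow_0)
    qed
    show ?thesis
    proof (rule inj_onI)
      fix x y assume "x \<in> K" "y \<in> K" "h0 x = h0 y"
      then show "x = y" using *[of x y] *[of y x] by (cases "n x \<le> n y") auto
    qed
  qed
  have surj: "\<exists>x\<in>K. h0 x = y" if y: "y \<in> K" for y
  proof -
    have yI: "y \<in> unit_ivl" using KI y .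
    have "\<exists>k>0. (g ^^ k) y \<in> K" using per_g[OF yI] y by metis
    then obtain k where k: "k > 0" "(g ^^ k) y \<in> K" by blast
    have gy: "g y \<in> unit_ivl" using IET_closed[OF g yI] .
    have "(g ^^ (k - 1)) (g y) \<in> K" using k by (metis Suc_pred' funpow_Suc_right o_apply)
    then obtain z i where z: "z \<in> K" "i < n z" "g y = (f ^^ i) z" using hit[OF gy] by blast
    have fy: "(f ^^ Suc i) z = y" using z(3) fg[OF yI] by simp
    have "Suc i = n z" using nmin[of "Suc i" z] z fy y by (metis Suc_lessI zero_less_Suc)
    then show ?thesis using z fy by (intro bexI[of _ z]) (auto simp: h0_def)
  qed
  have bij: "bij_betw h0 unit_ivl unit_ivl"
  proof -
    have 1: "bij_betw h0 K K" unfolding bij_betw_def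
      using inj h0K surj by (metis image_subset_iff subsetI subset_antisym imageI)
    have 2: "bij_betw h0 (unit_ivl - K) (unit_ivl - K)"
      by (rule bij_betwI[where g = "\<lambda>x. x"]) (auto simp: h0_def)
    have "K \<union> (unit_ivl - K) = unit_ivl" using KI by blast
    then show ?thesis using bij_betw_combine[OF 1 2] by auto
  qed
  have finB: "finite B" "card B \<le> 2 * card A"
  proof -
    show "finite B" using A by (simp add: B_def)
    have "card B \<le> card A + card ((\<lambda>a. a + \<delta>) ` A)" unfolding B_def by (rule card_Un_le)
    also have "card ((\<lambda>a. a + \<delta>) ` A) \<le> card A" using A by (intro card_image_le)
    finally show "card B \<le> 2 * card A" by simp
  qed
  define Z where "Z = {z \<in> K. \<exists>i>0. (f ^^ i) z \<in> B \<and> (\<forall>j. 0 < j \<longrightarrow> j < i \<longrightarrow> (f ^^ j) z \<notin> K)}"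
  have Z: "finite Z" "card Z \<le> card B"
  proof -
    have "\<exists>c. \<forall>z\<in>Z. 0 < c z \<and> (f ^^ c z) z \<in> B \<and> (\<forall>j. 0 < j \<longrightarrow> j < c z \<longrightarrow> (f ^^ j) z \<notin> K)"
      unfolding Z_def by (intro bchoice) blast
    then obtain c where c: "\<And>z. z \<in> Z \<Longrightarrow> 0 < c z" "\<And>z. z \<in> Z \<Longrightarrow> (f ^^ c z) z \<in> B"
      "\<And>z j. z \<in> Z \<Longrightarrow> 0 < j \<Longrightarrow> j < c z \<Longrightarrow> (f ^^ j) z \<notin> K" by blast
    have ZK: "z \<in> K" if "z \<in> Z" for z using that by (simp add: Z_def)
    have *: "x = y" if xy: "x \<in> Z" "y \<in> Z" "(f ^^ c x) x = (f ^^ c y) y" "c x \<le> c y" for x y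
    proof -
      let ?d = "c y - c x"
      have "(f ^^ c y) y = (f ^^ c x) ((f ^^ ?d) y)"
        using xy by (subst comp_apply[symmetric], subst funpow_add[symmetric]) simp
      then have "(g ^^ c x) ((f ^^ c x) ((f ^^ ?d) y)) = (g ^^ c x) ((f ^^ c x) x)" using xy by simp
      then have e: "(f ^^ ?d) y = x"
        using fgp(2)[OF clf[OF KI[OF ZK[OF xy(2)]]]] fgp(2)[OF KI[OF ZK[OF xy(1)]]] by simp
      have "?d < c y" using c(1)[OF xy(1)] xy(4) by simp
      then have "\<not> 0 < ?d" using c(3)[OF xy(2), of ?d] e ZK[OF xy(1)] by metis
      then have "?d = 0" by simp
      then show ?thesis using e by (simp only: funpow_0)
    qed
    have "inj_on (\<lambda>z. (f ^^ c z) z) Z"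
    proof (rule inj_onI)
      fix x y assume "x \<in> Z" "y \<in> Z" "(f ^^ c x) x = (f ^^ c y) y"
      then show "x = y" using *[of x y] *[of y x] by (cases "c x \<le> c y") auto
    qed
    moreover have "(\<lambda>z. (f ^^ c z) z) ` Z \<subseteq> B" using c by auto
    ultimately show "finite Z" "card Z \<le> card B"
      using finB(1) by (auto intro: inj_on_finite card_inj_on_le)
  qed
  have same: "(u \<in> K \<longleftrightarrow> v \<in> K) \<and> f v = f u + (v - u)"
    if uv: "0 \<le> u" "u \<le> v" "v < 1" "B \<inter> {u<..v} = {}" for u v
  proof
    show "f v = f u + (v - u)"
      using uv by (intro translates_offD[OF A(4)]) (auto simp: B_def)
    have "(u \<in> {a..<a + \<delta>}) = (v \<in> {a..<a + \<delta>})" if "a \<in> A" for a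
    proof -
      have "a \<in> B" "a + \<delta> \<in> B" using that by (auto simp: B_def)
      then have "a \<notin> {u<..v}" "a + \<delta> \<notin> {u<..v}" using uv by blast+
      then show ?thesis using uv(2) by auto
    qed
    then show "u \<in> K \<longleftrightarrow> v \<in> K" using uv unfolding K_def by auto
  qed
  have trh: "translates_off (B \<union> Z) h0"
  proof (rule translates_offI)
    fix x y :: real assume xy: "0 \<le> x" "x \<le> y" "y < 1" "(B \<union> Z) \<inter> {x<..y} = {}"
    have xyB: "B \<inter> {x<..y} = {}" using xy by auto
    have K: "x \<in> K \<longleftrightarrow> y \<in> K" using same[OF xy(1-3) xyB] by simp
    show "h0 y = h0 x + (y - x)"
    proof (cases "x \<in> K")
      case False
      then show ?thesis using K by (simp add: h0_def)
    next
      case True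
      have wK: "w \<in> K" if "x \<le> w" "w \<le> y" for w
      proof -
        have "B \<inter> {x<..w} = {}" using xyB that by auto
        then show ?thesis using same[of x w] True that xy by auto
      qed
      have xI: "x \<in> unit_ivl" "y \<in> unit_ivl" using xy by auto
      \<comment> \<open>Until the return of \<open>x\<close>, the interval \<open>[x, y]\<close> is moved by translations, is not cut by \<open>B\<close>,
        and does not meet \<open>K\<close> in between.\<close>
      have main: "(\<forall>w. x \<le> w \<longrightarrow> w \<le> y \<longrightarrow> (f ^^ i) w = (f ^^ i) x + (w - x)) \<and>
          (\<forall>j w. 0 < j \<longrightarrow> j < i \<longrightarrow> x \<le> w \<longrightarrow> w \<le> y \<longrightarrow> (f ^^ j) w \<notin> K) \<and>
          (0 < i \<longrightarrow> B \<inter> {(f ^^ i) x<..(f ^^ i) y} = {})"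
        if "i \<le> n x" for i
        using that
      proof (induction i)
        case 0
        show ?case by simp
      next
        case (Suc i)
        note IH = Suc.IH[OF Suc_leD[OF Suc.prems]]
        have IH1: "\<And>w. x \<le> w \<Longrightarrow> w \<le> y \<Longrightarrow> (f ^^ i) w = (f ^^ i) x + (w - x)"
          and IH2: "\<And>j w. 0 < j \<Longrightarrow> j < i \<Longrightarrow> x \<le> w \<Longrightarrow> w \<le> y \<Longrightarrow> (f ^^ j) w \<notin> K"
          and IH3: "0 < i \<Longrightarrow> B \<inter> {(f ^^ i) x<..(f ^^ i) y} = {}" using IH by blast+
        have noB: "B \<inter> {(f ^^ i) x<..(f ^^ i) w} = {}" if w: "x \<le> w" "w \<le> y" for w
        proof (cases "i = 0")
          case True
          then show ?thesis using xyB w by auto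
        next
          case False
          have "(f ^^ i) w \<le> (f ^^ i) y" using IH1[of w] IH1[of y] w by simp
          then show ?thesis using IH3 False by auto
        qed
        have st: "((f ^^ i) x \<in> K \<longleftrightarrow> (f ^^ i) w \<in> K) \<and>
          f ((f ^^ i) w) = f ((f ^^ i) x) + ((f ^^ i) w - (f ^^ i) x)" if w: "x \<le> w" "w \<le> y" for w
        proof (rule same)
          show "0 \<le> (f ^^ i) x" using clf[OF xI(1), of i] by simp
          show "(f ^^ i) x \<le> (f ^^ i) w" using IH1[OF w] w by simp
          show "(f ^^ i) w < 1" using clf[of w i] w xy by simp
          show "B \<inter> {(f ^^ i) x<..(f ^^ i) w} = {}" by (rule noB[OF w])
        qed
        have 1: "(f ^^ Suc i) w = (f ^^ Suc i) x + (w - x)" if w: "x \<le> w" "w \<le> y" for w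
          using st[OF w] IH1[OF w] by simp
        have 2: "(f ^^ j) w \<notin> K" if j: "0 < j" "j < Suc i" and w: "x \<le> w" "w \<le> y" for j w
        proof (cases "j = i")
          case True
          then have "(f ^^ i) x \<notin> K" using nmin[of i x] j Suc.prems by simp
          then show ?thesis using True st[OF w] by simp
        next
          case False
          then show ?thesis using IH2[of j w] j w by simp
        qed
        have 3: "B \<inter> {(f ^^ Suc i) x<..(f ^^ Suc i) y} = {}"
        proof (rule ccontr)
          assume "B \<inter> {(f ^^ Suc i) x<..(f ^^ Suc i) y} \<noteq> {}"
          then obtain b where b: "b \<in> B" "(f ^^ Suc i) x < b" "b \<le> (f ^^ Suc i) y" by auto
          define w where "w = x + (b - (f ^^ Suc i) x)"
          have w: "x < w" "w \<le> y" using b 1[of y] xy by (auto simp: w_def)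
          have "(f ^^ Suc i) w = b" using 1[of w] w by (simp add: w_def)
          then have "w \<in> Z" unfolding Z_def using b wK[of w] w 2
            by (intro CollectI conjI exI[of _ "Suc i"]) auto
          then show False using xy w by auto
        qed
        show ?case using 1 2 3 by blast
      qed
      note fin_ret = main[OF order_refl]
      have fy: "(f ^^ n x) y = (f ^^ n x) x + (y - x)" using fin_ret xy(2) by blast
      have nB: "B \<inter> {(f ^^ n x) x<..(f ^^ n x) y} = {}" using fin_ret n(1)[OF True] by blast
      have "(f ^^ n x) x \<in> K \<longleftrightarrow> (f ^^ n x) y \<in> K"
        using same[OF _ _ _ nB] clf[OF xI(1), of "n x"] clf[OF xI(2), of "n x"] fy xy(2) by simp
      then have "(f ^^ n x) y \<in> K" using n(2)[OF True] by blast
      then have "n y = n x"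
        by (rule nI[OF n(1)[OF True]]) (use fin_ret xy(2) in blast)
      then show ?thesis using True K fy by (simp add: h0_def)
    qed
  qed
  define h where "h = restrict h0 unit_ivl"
  have h: "h \<in> carrier IET"
    unfolding h_def using restrict_IET[OF bij _ trh] finB Z by simp
  have hx: "h x = h0 x" if "x \<in> unit_ivl" for x using that by (simp add: h_def)
  have "break_bound (4 * card A) h"
    unfolding break_bound_def
  proof (intro exI conjI)
    show "finite (B \<union> Z)" using finB Z by simp
    show "card (B \<union> Z) \<le> 4 * card A" using card_Un_le[of B Z] finB Z by simp
    show "translates_off (B \<union> Z) h" by (rule translates_off_cong[OF trh]) (simp add: hx)
  qed
  moreover define E where "E = inv\<^bsub>IET\<^esub> h \<otimes>\<^bsub>IET\<^esub> f"
  have E: "E \<in> carrier IET" using h f by (simp add: E_def)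
  have fE: "f = h \<otimes>\<^bsub>IET\<^esub> E" using h f by (simp add: E_def G.m_assoc[symmetric])
  have E1: "E y = x" if "y \<in> unit_ivl" "x \<in> unit_ivl" "h0 x = f y" for x y
    using that f h IET_inv_eq[OF h that(2)] by (simp add: E_def IET_mult hx)
  have Eout: "E y = f y" if "y \<in> unit_ivl" "f y \<notin> K" for y
    by (rule E1) (use that IET_closed[OF f that(1)] in \<open>simp_all add: h0_def\<close>)
  \<comment> \<open>Either \<open>x\<close> lies on a floor of the tower over some \<open>z \<in> K\<close>, which \<open>E\<close> traverses cyclically, or the
    whole orbit of \<open>x\<close> avoids \<open>K\<close> and \<open>E\<close> agrees with \<open>f\<close> on it.\<close>
  have "\<exists>q>0. (E ^^ q) x = x" if x: "x \<in> unit_ivl" for x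
  proof (cases "\<exists>k. (g ^^ k) x \<in> K")
    case True
    then obtain z i where z: "z \<in> K" "i < n z" "x = (f ^^ i) z" using hit[OF x] by blast
    have zI: "z \<in> unit_ivl" using KI z by blast
    have up: "(E ^^ j) z = (f ^^ j) z" if "j < n z" for j
      using that
    proof (induction j)
      case (Suc j)
      then have "f ((f ^^ j) z) \<notin> K" using nmin[of "Suc j" z] by simp
      then show ?case using Eout[OF clf[OF zI]] Suc by simp
    qed simp
    obtain m where m: "n z = Suc m" using n(1)[OF z(1)] gr0_implies_Suc by blast
    have "(E ^^ n z) z = E ((f ^^ m) z)" using up[of m] m by simp
    also have "\<dots> = z" using z m by (intro E1 clf zI) (simp add: h0_def)
    finally have Ez: "(E ^^ n z) z = z" .
    have "(E ^^ n z) x = (E ^^ n z) ((E ^^ i) z)" using up[OF z(2)] z by simp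
    also have "\<dots> = (E ^^ i) ((E ^^ n z) z)"
      by (subst (1 2) comp_apply[symmetric], subst (1 2) funpow_add[symmetric]) (simp add: add.commute)
    also have "\<dots> = x" using Ez up[OF z(2)] z by simp
    finally show ?thesis using n(1)[OF z(1)] by blast
  next
    case False
    then obtain p where p: "p > 0" "(g ^^ p) x = x" using per_g[OF x] by blast
    have fK: "(f ^^ k) x \<notin> K" for k
    proof -
      have per: "(f ^^ p) x = x" using per_gf[OF x p(2)] .
      let ?k = "k mod p"
      have kp: "?k < p" using p by simp
      have "(f ^^ k) x = (f ^^ ?k) x" using funpow_mod_eq[OF per] by simp
      also have "x = (g ^^ (?k + (p - ?k))) x" using p kp by simp
      then have "(f ^^ ?k) x = (f ^^ ?k) ((g ^^ ?k) ((g ^^ (p - ?k)) x))"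
        by (simp only: funpow_add o_apply)
      also have "\<dots> = (g ^^ (p - ?k)) x" by (rule fgp(1)[OF clg[OF x]])
      finally show ?thesis using False by auto
    qed
    have "(E ^^ k) x = (f ^^ k) x" for k
    proof (induction k)
      case (Suc k)
      then show ?case using Eout[OF clf[OF x, of k]] fK[of "Suc k"] by simp
    qed simp
    then have "(E ^^ p) x = x" using per_gf[OF x p(2)] by simp
    then show ?thesis using p by blast
  qed
  moreover have "h x = x" if "x \<in> unit_ivl" "x \<notin> (\<Union>a\<in>A. {a..<a + \<delta>})" for x
  proof -
    have "x \<notin> K" using that by (simp add: K_def)
    then show ?thesis using that by (simp add: hx h0_def)
  qed
  ultimately show ?thesis using h E fE by blast
qed


section \<open>The commutator length is at most four\<close>

lemma commutatorI:
  "a \<in> carrier IET \<Longrightarrow> b \<in> carrier IET \<Longrightarrow> commutator a b \<in> derived_set IET (carrier IET)"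
  by blast

lemma conj_commutator:
  assumes "u \<in> derived_set IET (carrier IET)" "\<phi> \<in> carrier IET"
  shows "inv\<^bsub>IET\<^esub> \<phi> \<otimes>\<^bsub>IET\<^esub> u \<otimes>\<^bsub>IET\<^esub> \<phi> \<in> derived_set IET (carrier IET)"
proof -
  obtain a b where ab: "a \<in> carrier IET" "b \<in> carrier IET" "u = commutator a b" using assms(1) by blast
  have cancel: "\<phi> \<otimes>\<^bsub>IET\<^esub> (inv\<^bsub>IET\<^esub> \<phi> \<otimes>\<^bsub>IET\<^esub> x) = x" if "x \<in> carrier IET" for x
    using that assms(2) by (simp add: G.m_assoc[symmetric])
  let ?c = "\<lambda>x. inv\<^bsub>IET\<^esub> \<phi> \<otimes>\<^bsub>IET\<^esub> x \<otimes>\<^bsub>IET\<^esub> \<phi>"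
  have c: "?c a \<in> carrier IET" "?c b \<in> carrier IET" using ab assms(2) by simp_all
  have "?c u = commutator (?c a) (?c b)"
    using ab assms(2) by (simp add: G.m_assoc G.inv_mult_group cancel)
  then show ?thesis using commutatorI[OF c] by (simp only:)
qed

lemma commutator_length_le:
  assumes "set cs \<subseteq> derived_set IET (carrier IET)" "foldr (\<otimes>\<^bsub>IET\<^esub>) cs \<one>\<^bsub>IET\<^esub> = g"
  shows "commutator_length IET g \<le> enat (length cs)"
  unfolding commutator_length_def using assms by (intro Inf_lower) blast

text \<open>Padding with the trivial commutator allows a prescribed number of factors.\<close>

lemma commutator_length_leD:
  assumes "commutator_length IET g \<le> enat n"
  shows "\<exists>cs. set cs \<subseteq> derived_set IET (carrier IET) \<and> length cs = n \<and>
    foldr (\<otimes>\<^bsub>IET\<^esub>) cs \<one>\<^bsub>IET\<^esub> = g"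
proof -
  have "commutator_length IET g < enat (Suc n)" using assms by (simp add: order_le_less_trans)
  then obtain cs where cs: "set cs \<subseteq> derived_set IET (carrier IET)"
    "foldr (\<otimes>\<^bsub>IET\<^esub>) cs \<one>\<^bsub>IET\<^esub> = g" "length cs \<le> n"
    unfolding commutator_length_def Inf_less_iff by auto
  have "commutator \<one>\<^bsub>IET\<^esub> \<one>\<^bsub>IET\<^esub> = \<one>\<^bsub>IET\<^esub>" by simp
  then have one: "\<one>\<^bsub>IET\<^esub> \<in> derived_set IET (carrier IET)" using G.one_closed by blast
  have "foldr (\<otimes>\<^bsub>IET\<^esub>) (replicate k \<one>\<^bsub>IET\<^esub>) \<one>\<^bsub>IET\<^esub> = \<one>\<^bsub>IET\<^esub>" for k
    by (induction k) auto
  moreover have "set (replicate k \<one>\<^bsub>IET\<^esub>) \<subseteq> derived_set IET (carrier IET)" for k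
    using one set_replicate_conv_if[of k "\<one>\<^bsub>IET\<^esub>"] by (simp only: split: if_split) blast
  ultimately show ?thesis using cs
    by (intro exI[of _ "cs @ replicate (n - length cs) \<one>\<^bsub>IET\<^esub>"])
       (simp del: UN_iff set_replicate)
qed

lemma separation_exists:
  assumes "finite A" "A \<subseteq> unit_ivl" "0 < (e::real)"
  obtains \<delta> where "0 < \<delta>" "\<delta> \<le> e" "\<And>a b. a \<in> A \<Longrightarrow> b \<in> A \<Longrightarrow> a < b \<Longrightarrow> a + \<delta> \<le> b"
    "\<And>a. a \<in> A \<Longrightarrow> a + \<delta> \<le> 1"
proof -
  define T where "T = (\<lambda>(a, b). b - a) ` {(a, b) \<in> A \<times> insert 1 A. a < b}"
  have "finite {(a, b) \<in> A \<times> insert 1 A. a < b}"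
    by (rule finite_subset[of _ "A \<times> insert 1 A"]) (use assms in auto)
  then have T: "finite (insert e T)" by (simp add: T_def)
  have "0 < Min (insert e T)" using T assms by (subst Min_gr_iff) (auto simp: T_def)
  moreover have le: "Min (insert e T) \<le> t" if "t \<in> insert e T" for t using T that by (rule Min_le)
  moreover have d: "a + Min (insert e T) \<le> b" if "a \<in> A" "b \<in> insert 1 A" "a < b" for a b
  proof -
    have "b - a \<in> T"
      using that unfolding T_def by (intro image_eqI[of _ _ "(a, b)"]) auto
    then show ?thesis using le[of "b - a"] by simp
  qed
  moreover have "a + Min (insert e T) \<le> 1" if "a \<in> A" for a
    using d[OF that, of 1] assms(2) that by auto
  ultimately show ?thesis using that[of "Min (insert e T)"] by blast
qed

lemma commutator_length_le_4:
  assumes C: "\<And>m::nat. 0 < m \<Longrightarrow> commutator_width_upto m < \<infinity>" and fD: "f \<in> derived_IET"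
  shows "commutator_length IET f \<le> enat 4"
proof -
  have DIET: "derived_IET \<subseteq> carrier IET" by (rule G.derived_in_carrier) simp
  have sub: "subgroup derived_IET IET" by (rule G.derived_is_subgroup) simp
  have comD: "derived_set IET (carrier IET) \<subseteq> derived_IET"
    unfolding derived_def by (auto intro: generate.incl)
  have f: "f \<in> carrier IET" using fD DIET by blast
  obtain A where A: "finite A" "0 \<in> A" "A \<subseteq> unit_ivl" "translates_off A f" using IET_breaks_unit[OF f] .
  define N where "N = card A"
  have N: "0 < N" using A by (auto simp: N_def card_gt_0_iff)
  \<comment> \<open>Bounds for the break points of the gathering map \<open>\<phi>\<close>, of \<open>h\<close> and of the inverse of \<open>\<phi>\<close>; \<open>k\<close> does
    not depend on \<open>n\<close> and \<open>\<delta>\<close>, which are chosen later.\<close>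
  define k where "k = (3 * N + 4 * N) + Suc (3 * N)"
  obtain m where m: "commutator_width_upto (Suc k) = enat m" using C[of "Suc k"] by auto
  \<comment> \<open>A power of two, since the rescaling lemma proceeds by halving.\<close>
  define n :: nat where "n = 2 ^ m"
  have n: "0 < n" "m \<le> n" by (auto simp: n_def less_imp_le)
  have "0 < 1 / (real N * real n)" using N n by simp
  then obtain \<delta> where \<delta>: "0 < \<delta>" "\<delta> \<le> 1 / (real N * real n)"
    and sep: "\<And>a b. a \<in> A \<Longrightarrow> b \<in> A \<Longrightarrow> a < b \<Longrightarrow> a + \<delta> \<le> b" "\<And>a. a \<in> A \<Longrightarrow> a + \<delta> \<le> 1"
    using separation_exists[OF A(1,3)] by metis
  have N\<delta>: "real N * \<delta> \<le> 1 / real n" using mult_left_mono[OF \<delta>(2), of "real N"] N by simp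
  obtain h E where h: "h \<in> carrier IET" and E: "E \<in> carrier IET" and fhE: "f = h \<otimes>\<^bsub>IET\<^esub> E"
    and bh: "break_bound (4 * N) h"
    and hx: "\<And>x. x \<in> unit_ivl \<Longrightarrow> x \<notin> (\<Union>a\<in>A. {a..<a + \<delta>}) \<Longrightarrow> h x = x"
    and per: "\<And>x. x \<in> unit_ivl \<Longrightarrow> \<exists>q>0. (E ^^ q) x = x"
    using first_return_decomposition[OF f A \<delta>(1) sep(1)] unfolding N_def by blast
  obtain u v where u: "u \<in> derived_set IET (carrier IET)" and v: "v \<in> derived_set IET (carrier IET)"
    and Euv: "E = u \<otimes>\<^bsub>IET\<^esub> v" using periodic_two_commutators[OF E per] by blast
  have uvD: "u \<in> derived_IET" "v \<in> derived_IET" using subsetD[OF comD] u v by blast+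
  have uvc: "u \<in> carrier IET" "v \<in> carrier IET" using uvD DIET by blast+
  have "A \<subseteq> {0..}" using A by auto
  from gather[OF \<delta>(1) A(1) this sep] obtain \<phi> where \<phi>: "\<phi> \<in> carrier IET" "break_bound (3 * N) \<phi>"
    and \<phi>x: "\<And>a x. a \<in> A \<Longrightarrow> x \<in> {a..<a + \<delta>} \<Longrightarrow> \<phi> x \<in> {0..<real N * \<delta>}"
    unfolding N_def by blast
  define h1 where "h1 = \<phi> \<otimes>\<^bsub>IET\<^esub> h \<otimes>\<^bsub>IET\<^esub> inv\<^bsub>IET\<^esub> \<phi>"
  have h1: "h1 \<in> carrier IET" using \<phi> h by (simp add: h1_def)
  have bh1: "break_bound k h1" unfolding h1_def k_def
    using \<phi> h bh by (intro break_bound_mult break_bound_inv) auto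
  have h1x: "h1 x = x" if x: "x \<in> unit_ivl" "1 / real n \<le> x" for x
  proof -
    let ?y = "(inv\<^bsub>IET\<^esub> \<phi>) x"
    have y: "?y \<in> unit_ivl" "\<phi> ?y = x"
      using IET_closed[OF G.inv_closed[OF \<phi>(1)] x(1)] IET_f_inv[OF \<phi>(1) x(1)] by blast+
    have "?y \<notin> (\<Union>a\<in>A. {a..<a + \<delta>})"
    proof
      assume "?y \<in> (\<Union>a\<in>A. {a..<a + \<delta>})"
      then have "x \<in> {0..<real N * \<delta>}" using \<phi>x[of _ ?y] y(2) by auto
      then show False using N\<delta> x by simp
    qed
    then have "h ?y = ?y" using hx y by blast
    then show ?thesis using \<phi> h x y by (simp add: h1_def IET_mult del: atLeastLessThan_iff)
  qed
  obtain g where g: "g \<in> carrier IET" "shrink n g = h1" "break_bound k g"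
    using shrink_exists[OF h1 n(1) h1x bh1] by blast
  have "h = f \<otimes>\<^bsub>IET\<^esub> inv\<^bsub>IET\<^esub> E" using fhE h E by (simp add: G.m_assoc)
  moreover have "E \<in> derived_IET" unfolding Euv by (rule subgroup.m_closed[OF sub uvD])
  ultimately have "h \<in> derived_IET"
    by (simp only:) (intro subgroup.m_closed[OF sub fD] subgroup.m_inv_closed[OF sub])
  then have "h1 \<in> derived_IET" unfolding h1_def
    using G.derived_self_is_normal \<phi>(1) by (simp add: normal.inv_op_closed2)
  then have "g \<in> derived_IET" using derived_shrink_power_2[OF g(1), of m] g(2) by (simp add: n_def)
  moreover have "g \<in> IET_upto (Suc k)" using IET_uptoI[OF g(1,3)] .
  ultimately have "commutator_length IET g \<le> commutator_width_upto (Suc k)"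
    unfolding commutator_width_upto_def by (intro SUP_upper) blast
  also have "\<dots> \<le> enat n" using m n by simp
  finally obtain cs where cs: "set cs \<subseteq> derived_set IET (carrier IET)" "length cs = n"
    "foldr (\<otimes>\<^bsub>IET\<^esub>) cs \<one>\<^bsub>IET\<^esub> = g" using commutator_length_leD by blast
  obtain u1 v1 where u1: "u1 \<in> derived_set IET (carrier IET)" and v1: "v1 \<in> derived_set IET (carrier IET)"
    and h1uv: "h1 = u1 \<otimes>\<^bsub>IET\<^esub> v1"
    using shrink_two_commutators[OF cs(1,2) n(1)] cs(3) g(2) by auto
  have uv1c: "u1 \<in> carrier IET" "v1 \<in> carrier IET"
    using subsetD[OF comD u1] subsetD[OF comD v1] DIET by blast+
  let ?c = "\<lambda>x. inv\<^bsub>IET\<^esub> \<phi> \<otimes>\<^bsub>IET\<^esub> x \<otimes>\<^bsub>IET\<^esub> \<phi>"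
  have cancel: "\<phi> \<otimes>\<^bsub>IET\<^esub> (inv\<^bsub>IET\<^esub> \<phi> \<otimes>\<^bsub>IET\<^esub> x) = x" "inv\<^bsub>IET\<^esub> \<phi> \<otimes>\<^bsub>IET\<^esub> (\<phi> \<otimes>\<^bsub>IET\<^esub> x) = x"
    if "x \<in> carrier IET" for x
    using that \<phi>(1) by (simp_all add: G.m_assoc[symmetric])
  have "h = ?c h1" unfolding h1_def using \<phi>(1) h by (simp add: G.m_assoc cancel)
  also have "\<dots> = ?c u1 \<otimes>\<^bsub>IET\<^esub> ?c v1"
    unfolding h1uv using \<phi>(1) uv1c by (simp add: G.m_assoc cancel)
  finally have "f = foldr (\<otimes>\<^bsub>IET\<^esub>) [?c u1, ?c v1, u, v] \<one>\<^bsub>IET\<^esub>"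
    using fhE Euv \<phi>(1) uv1c uvc by (simp add: G.m_assoc)
  moreover have "set [?c u1, ?c v1, u, v] \<subseteq> derived_set IET (carrier IET)"
    using conj_commutator[OF u1 \<phi>(1)] conj_commutator[OF v1 \<phi>(1)] u v by (simp del: UN_iff)
  moreover have "length [?c u1, ?c v1, u, v] = 4" by simp
  ultimately show ?thesis
    using commutator_length_le[of "[?c u1, ?c v1, u, v]" f] by metis
qed

theorem theorem3:
  assumes "\<And>m::nat. 0 < m \<Longrightarrow> commutator_width_upto m < \<infinity>"
  shows "uniformly_perfect IET \<and> commutator_width IET \<le> 5"
proof -
  have "commutator_width IET \<le> enat 4"
    unfolding commutator_width_def
    using commutator_length_le_4[OF assms] by (intro SUP_least)
  moreover have "enat 4 < \<infinity>" "enat 4 \<le> 5" by (simp_all add: numeral_eq_enat)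
  ultimately show ?thesis unfolding uniformly_perfect_def
    by (meson order_le_less_trans order_trans)
qed

end
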